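(* Let $\sigma$ be an arbitrary quantum state (randomness source) on a finite-dimensional system $B$ with eigenspace decomposition $\sigma=\sum_i\lambda_i\Pi_i$, and let $r_i=\mathrm{Tr}\,\Pi_i$. Then the maximal extractable min-entropy from $\sigma$ is the catalytic min-entropy of $\sigma$, $$S_{\min}^\diamond(\sigma)=-\max_i\log_2(\lambda_i/r_i).$$
   Context: All systems are finite-dimensional. $S_{\min}(\rho)=-\log_2\|\rho\|$, with $\|\rho\|$ the largest eigenvalue of $\rho$. In the eigenspace decomposition, the $\lambda_i$ are the distinct eigenvalues of $\sigma$ and $\Pi_i$ are the orthogonal projectors onto the corresponding eigenspaces. A quantum map $\Phi$ on a system $A$ is a catalytic map using the catalyst $\sigma_B$ if there are a unitary $U$ on $AB$ and a unitary $V$ on $B$ with $\mathrm{Tr}_B\,U(\rho_A\otimes\sigma_B)U^\dagger=\Phi(\rho)$ and $\mathrm{Tr}_A\,U(\rho_A\otimes\sigma_B)U^\dagger=V\sigma_BV^\dagger$ for all states $\rho$ on $A$. The maximal extractable min-entropy from $\sigma$ is the maximum of $S_{\min}((\mathcal{I}_R\otimes\Phi)(\rho))-S_{\min}(\rho)$ over all finite-dimensional systems $A$ and reference systems $R$, all catalytic maps $\Phi$ on $A$ using the catalyst $\sigma$, and all states $\rho$ on $RA$. *)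

theory Defs
  imports
    Complex_Main
    "Jordan_Normal_Form.Schur_Decomposition"
    "Jordan_Normal_Form.Spectral_Radius"
begin

text \<open>
  A system of dimension \<open>d\<close> has state space \<open>carrier_vec d\<close>, its operators are \<open>carrier_mat d d\<close>.
  A composite system \<open>XY\<close> with dimensions \<open>dX\<close>, \<open>dY\<close> has dimension \<open>dX * dY\<close>; the product basis
  vector with indices \<open>x < dX\<close>, \<open>y < dY\<close> sits at position \<open>x * dY + y\<close>.
\<close>

subsection \<open>Operators and states\<close>

definition mat_trace :: "complex mat \<Rightarrow> complex" where
  "mat_trace A = (\<Sum>i<dim_row A. A $$ (i, i))"

definition hermitian_mat :: "nat \<Rightarrow> complex mat \<Rightarrow> bool" where
  "hermitian_mat d A \<longleftrightarrow> A \<in> carrier_mat d d \<and> mat_adjoint A = A"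

definition unitary_mat :: "nat \<Rightarrow> complex mat \<Rightarrow> bool" where
  "unitary_mat d U \<longleftrightarrow>
     U \<in> carrier_mat d d \<and> mat_adjoint U * U = 1\<^sub>m d \<and> U * mat_adjoint U = 1\<^sub>m d"

definition positive_mat :: "nat \<Rightarrow> complex mat \<Rightarrow> bool" where
  "positive_mat d A \<longleftrightarrow>
     hermitian_mat d A \<and> (\<forall>v \<in> carrier_vec d. 0 \<le> Re ((A *\<^sub>v v) \<bullet>c v))"

definition quantum_state :: "nat \<Rightarrow> complex mat \<Rightarrow> bool" where
  "quantum_state d \<rho> \<longleftrightarrow> positive_mat d \<rho> \<and> mat_trace \<rho> = 1"

text \<open>Only used for Hermitian matrices of positive dimension, whose spectrum is real, finite and
  nonempty.\<close>

definition largest_eigenvalue :: "complex mat \<Rightarrow> real" where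
  "largest_eigenvalue A = Max (Re ` spectrum A)"

definition min_entropy :: "complex mat \<Rightarrow> real" where
  "min_entropy \<rho> = - log 2 (largest_eigenvalue \<rho>)"

subsection \<open>Composite systems\<close>

definition tensor_mat :: "complex mat \<Rightarrow> complex mat \<Rightarrow> complex mat" where
  "tensor_mat A B =
     mat (dim_row A * dim_row B) (dim_col A * dim_col B)
       (\<lambda>(i, j). A $$ (i div dim_row B, j div dim_col B) * B $$ (i mod dim_row B, j mod dim_col B))"

definition trace_fst :: "nat \<Rightarrow> nat \<Rightarrow> complex mat \<Rightarrow> complex mat" where
  "trace_fst dX dY M = mat dY dY (\<lambda>(i, j). \<Sum>k<dX. M $$ (k * dY + i, k * dY + j))"

definition trace_snd :: "nat \<Rightarrow> nat \<Rightarrow> complex mat \<Rightarrow> complex mat" where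
  "trace_snd dX dY M = mat dX dX (\<lambda>(i, j). \<Sum>k<dY. M $$ (i * dY + k, j * dY + k))"

subsection \<open>Quantum maps\<close>

text \<open>Writing an operator on \<open>RA\<close> as the sum over \<open>p\<close>, \<open>q\<close> of \<open>|p><q|\<close> (on \<open>R\<close>) tensor its block
  \<open>M p q\<close> (on \<open>A\<close>), the map \<open>I\<^sub>R\<close> tensor \<open>\<Phi>\<close> replaces each block by its image under \<open>\<Phi>\<close>.\<close>

definition mat_block :: "nat \<Rightarrow> complex mat \<Rightarrow> nat \<Rightarrow> nat \<Rightarrow> complex mat" where
  "mat_block dA M p q = mat dA dA (\<lambda>(i, j). M $$ (p * dA + i, q * dA + j))"

definition id_tensor_map ::
  "nat \<Rightarrow> nat \<Rightarrow> (complex mat \<Rightarrow> complex mat) \<Rightarrow> complex mat \<Rightarrow> complex mat" where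
  "id_tensor_map dR dA \<Phi> M =
     mat (dR * dA) (dR * dA)
       (\<lambda>(i, j). \<Phi> (mat_block dA M (i div dA) (j div dA)) $$ (i mod dA, j mod dA))"

text \<open>Completely positive trace-preserving linear maps on the operators of a system.\<close>

definition quantum_map :: "nat \<Rightarrow> (complex mat \<Rightarrow> complex mat) \<Rightarrow> bool" where
  "quantum_map d \<Phi> \<longleftrightarrow>
     (\<forall>X \<in> carrier_mat d d. \<Phi> X \<in> carrier_mat d d) \<and>
     (\<forall>X \<in> carrier_mat d d. \<forall>Y \<in> carrier_mat d d. \<Phi> (X + Y) = \<Phi> X + \<Phi> Y) \<and>
     (\<forall>c. \<forall>X \<in> carrier_mat d d. \<Phi> (c \<cdot>\<^sub>m X) = c \<cdot>\<^sub>m \<Phi> X) \<and>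
     (\<forall>X \<in> carrier_mat d d. mat_trace (\<Phi> X) = mat_trace X) \<and>
     (\<forall>k X. positive_mat (k * d) X \<longrightarrow> positive_mat (k * d) (id_tensor_map k d \<Phi> X))"

definition catalytic_map ::
  "nat \<Rightarrow> nat \<Rightarrow> complex mat \<Rightarrow> (complex mat \<Rightarrow> complex mat) \<Rightarrow> bool" where
  "catalytic_map dA dB \<sigma> \<Phi> \<longleftrightarrow>
     quantum_map dA \<Phi> \<and>
     (\<exists>U V. unitary_mat (dA * dB) U \<and> unitary_mat dB V \<and>
        (\<forall>\<rho>. quantum_state dA \<rho> \<longrightarrow>
           trace_snd dA dB (U * tensor_mat \<rho> \<sigma> * mat_adjoint U) = \<Phi> \<rho> \<and>
           trace_fst dA dB (U * tensor_mat \<rho> \<sigma> * mat_adjoint U) = V * \<sigma> * mat_adjoint V))"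

subsection \<open>Extractable min-entropy\<close>

definition extractable_min_entropies :: "nat \<Rightarrow> complex mat \<Rightarrow> real set" where
  "extractable_min_entropies dB \<sigma> =
     {min_entropy (id_tensor_map dR dA \<Phi> \<rho>) - min_entropy \<rho> | dA dR \<Phi> \<rho>.
        catalytic_map dA dB \<sigma> \<Phi> \<and> quantum_state (dR * dA) \<rho>}"

text \<open>\<open>m\<close> is an attained maximum, not just a supremum.\<close>

definition is_maximal_extractable_min_entropy :: "nat \<Rightarrow> complex mat \<Rightarrow> real \<Rightarrow> bool" where
  "is_maximal_extractable_min_entropy dB \<sigma> m \<longleftrightarrow>
     m \<in> extractable_min_entropies dB \<sigma> \<and> (\<forall>x \<in> extractable_min_entropies dB \<sigma>. x \<le> m)"

subsection \<open>Eigenspace decomposition and catalytic min-entropy\<close>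

definition eigenspace :: "nat \<Rightarrow> complex mat \<Rightarrow> complex \<Rightarrow> complex vec set" where
  "eigenspace d A e = {v \<in> carrier_vec d. A *\<^sub>v v = e \<cdot>\<^sub>v v}"

definition orthogonal_projector_onto :: "nat \<Rightarrow> complex vec set \<Rightarrow> complex mat \<Rightarrow> bool" where
  "orthogonal_projector_onto d W P \<longleftrightarrow>
     hermitian_mat d P \<and> P * P = P \<and> (\<lambda>v. P *\<^sub>v v) ` carrier_vec d = W"

definition eigenspace_decomposition ::
  "nat \<Rightarrow> complex mat \<Rightarrow> 'i set \<Rightarrow> ('i \<Rightarrow> real) \<Rightarrow> ('i \<Rightarrow> complex mat) \<Rightarrow> bool" where
  "eigenspace_decomposition d \<sigma> I lam P \<longleftrightarrow>
     finite I \<and> inj_on lam I \<and>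
     (\<lambda>i. complex_of_real (lam i)) ` I = spectrum \<sigma> \<and>
     (\<forall>i \<in> I. orthogonal_projector_onto d (eigenspace d \<sigma> (complex_of_real (lam i))) (P i)) \<and>
     \<sigma> = mat d d (\<lambda>(a, b). \<Sum>i \<in> I. complex_of_real (lam i) * P i $$ (a, b))"

text \<open>The eigenvalue 0, if present, contributes \<open>log 0 = -\<infinity>\<close> to the maximum and is therefore left
  out; the library's convention \<open>log 2 0 = 0\<close> would give a wrong value.\<close>

definition catalytic_min_entropy :: "'i set \<Rightarrow> ('i \<Rightarrow> real) \<Rightarrow> ('i \<Rightarrow> real) \<Rightarrow> real" where
  "catalytic_min_entropy I lam r = - Max ((\<lambda>i. log 2 (lam i / r i)) ` {i \<in> I. lam i \<noteq> 0})"

end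

theory Submission
  imports Defs
begin

text \<open>
  Work in an eigenbasis of the catalyst and absorb the unitary \<open>V\<close> into \<open>U\<close>. For the maximally mixed
  input the evolved state has the same Frobenius norm as the product of its marginals, so it equals
  this product and \<open>U\<close> commutes with the catalyst, i.e. it preserves the eigenspaces. Hence, if \<open>v\<close> is a
  top eigenvector of \<open>\<rho>\<close> and \<open>m\<close> a basis vector of the eigenspace of \<open>\<lambda>\<^sub>i\<close>, the image of \<open>v \<otimes> m\<close> is
  spread over \<open>r\<^sub>i\<close> catalyst states only, one of which has weight at least \<open>1 / r\<^sub>i\<close>; the Rayleigh
  quotient of the output at the corresponding vector is at least \<open>(\<lambda>\<^sub>i / r\<^sub>i) \<parallel>\<rho>\<parallel>\<close>.

  Equality is attained by a permutation: the system first records the basis state of the catalyst in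
  one register and then shifts the catalyst cyclically within its eigenspace, controlled by a second
  register prepared in a uniform superposition.
\<close>

subsection \<open>Adjoints and unitaries\<close>

text \<open>The maximally mixed input is decisive because its factor on the system is a multiple of
  the identity: the Frobenius inner product of the evolved state with the initial product state then
  sees only the catalyst marginal, which is fixed by assumption. Unitary invariance of the norm
  leaves no room for a difference. A catalytic map is tied to its unitary only on states, while an
  entangled input on \<open>RA\<close> feeds it arbitrary blocks, so agreement has to be extended by
  linearity. The weight enters the quadratic form squared, but one factor cancels against the norm
  of the test vector, so the loss is \<open>1 / r\<close> and not its square. In the construction
  one shift register must serve all eigenspaces at once, so its dimension is a common multiple of
  theirs, namely \<open>fact b\<close>. The record in the first register keeps output parts from
  different catalyst states orthogonal; without it their eigenvalues could add up. It is added
  modulo \<open>b\<close>, so that the evolution is a permutation that returns the catalyst for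
  every input and not just for the prepared one.\<close>

lemma mat_adjoint_dim [simp]:
  "dim_row (mat_adjoint A) = dim_col A" "dim_col (mat_adjoint A) = dim_row A"
  unfolding mat_adjoint_def by auto

lemma mat_adjoint_carrier [simp, intro]:
  "A \<in> carrier_mat n m \<Longrightarrow> mat_adjoint A \<in> carrier_mat m n"
  by (intro carrier_matI) auto

lemma mat_adjoint_index [simp]:
  fixes A :: "complex mat"
  assumes "i < dim_col A" "j < dim_row A"
  shows "mat_adjoint A $$ (i, j) = cnj (A $$ (j, i))"
  using assms unfolding mat_adjoint_def by (simp add: mat_of_rows_index)

lemma mat_adjoint_adjoint [simp]: "mat_adjoint (mat_adjoint A) = (A :: complex mat)"
  by (rule eq_matI) auto

lemma square_mult_closed [simp]:
  "A \<in> carrier_mat n n \<Longrightarrow> B \<in> carrier_mat n n \<Longrightarrow> A * B \<in> carrier_mat n n"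
  by (rule mult_carrier_mat)

lemma square_mult_assoc:
  assumes "A \<in> carrier_mat n n" "B \<in> carrier_mat n n" "C \<in> carrier_mat n n"
  shows "A * B * C = A * (B * C)"
  using assms by (rule assoc_mult_mat)

lemma index_mult_mat_sum:
  assumes "A \<in> carrier_mat n m" "B \<in> carrier_mat m k" "i < n" "j < k"
  shows "(A * B) $$ (i, j) = (\<Sum>x<m. A $$ (i, x) * B $$ (x, j))"
  using assms by (auto simp: scalar_prod_def lessThan_atLeast0 intro!: sum.cong)

lemma mat_adjoint_mult:
  fixes A B :: "complex mat"
  assumes "A \<in> carrier_mat n m" "B \<in> carrier_mat m k"
  shows "mat_adjoint (A * B) = mat_adjoint B * mat_adjoint A"
proof (rule eq_matI)
  fix i j assume "i < dim_row (mat_adjoint B * mat_adjoint A)" "j < dim_col (mat_adjoint B * mat_adjoint A)"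
  hence ij: "i < k" "j < n" using assms by auto
  have "mat_adjoint (A * B) $$ (i, j) = cnj ((A * B) $$ (j, i))"
    using assms ij by (intro mat_adjoint_index) auto
  also have "\<dots> = (\<Sum>x<m. cnj (A $$ (j, x)) * cnj (B $$ (x, i)))"
    by (subst index_mult_mat_sum[OF assms ij(2,1)]) simp
  also have "\<dots> = (mat_adjoint B * mat_adjoint A) $$ (i, j)"
    using assms ij by (subst index_mult_mat_sum[of _ k m _ n]) (auto intro!: sum.cong)
  finally show "mat_adjoint (A * B) $$ (i, j) = (mat_adjoint B * mat_adjoint A) $$ (i, j)" .
qed (use assms in auto)

lemma unitary_matD:
  assumes "unitary_mat d U"
  shows "U \<in> carrier_mat d d" "mat_adjoint U \<in> carrier_mat d d"
    "mat_adjoint U * U = 1\<^sub>m d" "U * mat_adjoint U = 1\<^sub>m d"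
  using assms unfolding unitary_mat_def by auto

lemma unitary_mat_adjoint: "unitary_mat d U \<Longrightarrow> unitary_mat d (mat_adjoint U)"
  unfolding unitary_mat_def by auto

lemma adjoint_mult_cancel:
  assumes "unitary_mat d U" "A \<in> carrier_mat d k"
  shows "mat_adjoint U * (U * A) = A" "U * (mat_adjoint U * A) = A"
  using assms(2) unitary_matD[OF assms(1)]
  by (simp_all flip: assoc_mult_mat[of _ d d _ d _ k])

lemma unitary_mat_mult:
  assumes "unitary_mat d U" "unitary_mat d V"
  shows "unitary_mat d (U * V)"
proof -
  note U = unitary_matD[OF assms(1)] and V = unitary_matD[OF assms(2)]
  have adj: "mat_adjoint (U * V) = mat_adjoint V * mat_adjoint U"
    by (rule mat_adjoint_mult[OF U(1) V(1)])
  have "mat_adjoint V * mat_adjoint U * (U * V) = mat_adjoint V * (mat_adjoint U * (U * V))"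
    using U V by (intro assoc_mult_mat) auto
  also have "\<dots> = 1\<^sub>m d" using adjoint_mult_cancel(1)[OF assms(1) V(1)] V by simp
  finally have 1: "mat_adjoint (U * V) * (U * V) = 1\<^sub>m d" by (simp add: adj)
  have "U * V * (mat_adjoint V * mat_adjoint U) = U * (V * (mat_adjoint V * mat_adjoint U))"
    using U V by (intro assoc_mult_mat) auto
  also have "\<dots> = 1\<^sub>m d" using adjoint_mult_cancel(2)[OF assms(2) U(2)] U by simp
  finally have 2: "U * V * mat_adjoint (U * V) = 1\<^sub>m d" by (simp add: adj)
  show ?thesis unfolding unitary_mat_def using 1 2 U V by auto
qed

lemma unitary_conj_cancel:
  assumes "unitary_mat d U" "A \<in> carrier_mat d d"
  shows "U * (mat_adjoint U * A * U) * mat_adjoint U = A"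
    "mat_adjoint U * (U * A * mat_adjoint U) * U = A"
proof -
  have *: "U * (mat_adjoint U * A * U) * mat_adjoint U = A"
    if U: "unitary_mat d U" for U
  proof -
    note c = unitary_matD[OF U]
    have "U * (mat_adjoint U * A * U) = U * (mat_adjoint U * (A * U))"
      using c assms(2) by (subst square_mult_assoc[of _ d]) auto
    also have "\<dots> = A * U"
      using c assms(2) by (intro adjoint_mult_cancel(2)[OF U]) auto
    finally have eq: "U * (mat_adjoint U * A * U) = A * U" .
    show ?thesis
      unfolding eq using c assms(2) by (simp add: square_mult_assoc[of _ d])
  qed
  show "U * (mat_adjoint U * A * U) * mat_adjoint U = A" by (rule *[OF assms(1)])
  show "mat_adjoint U * (U * A * mat_adjoint U) * U = A"
    using *[OF unitary_mat_adjoint[OF assms(1)]] by simp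
qed

lemma hermitian_matD:
  assumes "hermitian_mat d A"
  shows "A \<in> carrier_mat d d" "\<And>i j. i < d \<Longrightarrow> j < d \<Longrightarrow> A $$ (j, i) = cnj (A $$ (i, j))"
proof -
  show A: "A \<in> carrier_mat d d" using assms unfolding hermitian_mat_def by auto
  fix i j assume "i < d" "j < d"
  thus "A $$ (j, i) = cnj (A $$ (i, j))"
    using mat_adjoint_index[of j A i] A assms unfolding hermitian_mat_def by auto
qed

lemma hermitian_matI:
  assumes "A \<in> carrier_mat d d" "\<And>i j. i < d \<Longrightarrow> j < d \<Longrightarrow> A $$ (j, i) = cnj (A $$ (i, j))"
  shows "hermitian_mat d A"
proof -
  have "mat_adjoint A = A"
  proof (rule eq_matI)
    fix i j assume "i < dim_row A" "j < dim_col A"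
    hence ij: "i < d" "j < d" using assms(1) by auto
    show "mat_adjoint A $$ (i, j) = A $$ (i, j)"
      using assms(1) ij assms(2)[OF ij(2,1)] by (subst mat_adjoint_index) auto
  qed (use assms(1) in auto)
  thus ?thesis unfolding hermitian_mat_def using assms(1) by auto
qed

lemma hermitian_mat_conj:
  assumes "hermitian_mat d A" "Q \<in> carrier_mat d d"
  shows "hermitian_mat d (Q * A * mat_adjoint Q)"
proof -
  have A: "A \<in> carrier_mat d d" "mat_adjoint A = A" using assms(1) unfolding hermitian_mat_def by auto
  have "mat_adjoint (Q * A * mat_adjoint Q) = Q * (A * mat_adjoint Q)"
    using A assms(2) by (simp add: mat_adjoint_mult[of _ d d _ d])
  thus ?thesis unfolding hermitian_mat_def using A assms(2)
    by (auto simp: square_mult_assoc[of _ d])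
qed

subsection \<open>The spectral theorem\<close>

definition real_diag :: "nat \<Rightarrow> (nat \<Rightarrow> real) \<Rightarrow> complex mat" where
  "real_diag n s = mat n n (\<lambda>(i, j). if i = j then complex_of_real (s i) else 0)"

lemma real_diag_carrier [simp, intro]: "real_diag n s \<in> carrier_mat n n"
  by (simp add: real_diag_def)

lemma real_diag_index [simp]:
  "i < n \<Longrightarrow> j < n \<Longrightarrow> real_diag n s $$ (i, j) = (if i = j then complex_of_real (s i) else 0)"
  by (simp add: real_diag_def)

lemma conj_real_diag_index:
  assumes "W \<in> carrier_mat n n" "i < n" "j < n"
  shows "(W * real_diag n s * mat_adjoint W) $$ (i, j)
    = (\<Sum>m<n. complex_of_real (s m) * W $$ (i, m) * cnj (W $$ (j, m)))"
proof -
  have "(W * real_diag n s) $$ (i, m) = W $$ (i, m) * complex_of_real (s m)" if "m < n" for m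
  proof -
    have "(W * real_diag n s) $$ (i, m) = (\<Sum>x<n. W $$ (i, x) * real_diag n s $$ (x, m))"
      using assms that by (intro index_mult_mat_sum) auto
    also have "\<dots> = (\<Sum>x<n. if x = m then W $$ (i, x) * complex_of_real (s x) else 0)"
      using that by (intro sum.cong) auto
    finally show ?thesis using that by simp
  qed
  thus ?thesis
    using assms by (subst index_mult_mat_sum[of _ n n _ n]) (auto intro!: sum.cong)
qed

text \<open>Householder reflection \<open>1 - 2 u u\<^sup>* / |u|\<^sup>2\<close> with \<open>u = e\<^sub>0 - v\<close>; for \<open>v = e\<^sub>0\<close> the convention
  \<open>x / 0 = 0\<close> makes it the identity.\<close>

lemma unitary_with_first_column:
  fixes v :: "nat \<Rightarrow> complex"
  assumes n: "0 < n" and norm: "(\<Sum>i<n. (cmod (v i))\<^sup>2) = 1" and v0: "v 0 \<in> \<real>"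
  obtains Q where "unitary_mat n Q" "\<And>i. i < n \<Longrightarrow> Q $$ (i, 0) = v i"
proof -
  define u where "u i = (if i = 0 then 1 else 0) - v i" for i :: nat
  define N where "N = (\<Sum>i<n. (cmod (u i))\<^sup>2)"
  define c where "c = complex_of_real (2 / N)"
  define Q where "Q = mat n n (\<lambda>(i, j). (if i = j then 1 else 0) - c * u i * cnj (u j))"
  have Qc: "Q \<in> carrier_mat n n" by (simp add: Q_def)
  have herm: "hermitian_mat n Q"
    by (rule hermitian_matI) (auto simp: Q_def c_def)
  have cN: "c * complex_of_real N * c = 2 * c" by (simp add: c_def)
  have uu: "(\<Sum>i<n. cnj (u i) * u i) = complex_of_real N"
    by (simp add: N_def complex_norm_square mult.commute del: of_real_power)
  have QQ: "Q * Q = 1\<^sub>m n"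
  proof (rule eq_matI)
    fix i j assume "i < dim_row (1\<^sub>m n :: complex mat)" "j < dim_col (1\<^sub>m n :: complex mat)"
    hence ij: "i < n" "j < n" by auto
    have "(Q * Q) $$ (i, j) = (\<Sum>k<n. ((if i = k then 1 else 0) - c * u i * cnj (u k)) *
        ((if k = j then 1 else 0) - c * u k * cnj (u j)))"
      using ij Qc by (subst index_mult_mat_sum[of _ n n _ n]) (auto simp: Q_def intro!: sum.cong)
    also have "\<dots> = (\<Sum>k<n. (if k = i then (if k = j then 1 else 0) else 0)
        - (if k = i then c * u k * cnj (u j) else 0)
        - (if k = j then c * u i * cnj (u k) else 0)
        + c * u i * (cnj (u k) * u k) * (c * cnj (u j)))"
      by (intro sum.cong) (auto simp: algebra_simps)
    also have "\<dots> = (if i = j then 1 else 0) - c * u i * cnj (u j) - c * u i * cnj (u j)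
        + c * u i * complex_of_real N * (c * cnj (u j))"
      using ij by (simp add: sum.distrib sum_subtractf uu flip: sum_distrib_left sum_distrib_right)
    also have "\<dots> = (if i = j then 1 else 0) + (c * complex_of_real N * c - 2 * c) * u i * cnj (u j)"
      by (simp add: algebra_simps)
    finally show "(Q * Q) $$ (i, j) = 1\<^sub>m n $$ (i, j)" using ij by (simp add: cN)
  qed (use Qc in auto)
  have "unitary_mat n Q"
    using herm QQ unfolding unitary_mat_def hermitian_mat_def by auto
  moreover have "Q $$ (i, 0) = v i" if i: "i < n" for i
  proof -
    have cv0: "cnj (v 0) = v 0" using v0 by (simp add: Reals_cnj_iff)
    have "(cmod (u i))\<^sup>2 = (cmod (v i))\<^sup>2 + (if i = 0 then 1 - 2 * Re (v 0) else 0)" for i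
      unfolding u_def cmod_power2 by (auto simp: power2_eq_square algebra_simps)
    hence N: "N = 2 - 2 * Re (v 0)"
      unfolding N_def using n norm by (simp add: sum.distrib)
    have v0': "v 0 = complex_of_real (Re (v 0))" using v0 by simp
    show ?thesis
    proof (cases "N = 0")
      case True
      hence "u j = 0" if "j < n" for j
        using that unfolding N_def by (subst (asm) sum_nonneg_eq_0_iff) auto
      hence "u i = 0" using i by auto
      thus ?thesis using i n by (auto simp: Q_def u_def)
    next
      case False
      \<comment> \<open>Reality of \<open>v 0\<close> enters here:
        \<open>N = 2 - 2 * Re (v 0)\<close> is twice \<open>u 0\<close>, so \<open>c\<close> is the
        inverse of \<open>u 0\<close>.\<close>
      have "c * cnj (u 0) = 1"
        using False by (subst (asm) N, subst c_def, subst N, subst u_def, simp add: cv0, subst v0')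
          (simp add: field_simps flip: of_real_diff of_real_mult)
      hence "Q $$ (i, 0) = (if i = 0 then 1 else 0) - u i"
        using i n by (simp add: Q_def mult.assoc mult.commute[of "u i"])
      thus ?thesis by (simp add: u_def)
    qed
  qed
  ultimately show thesis by (rule that)
qed

text \<open>A reflection can carry the first basis vector to a given unit vector only if their inner
  product is real. The eigenvector is therefore also multiplied by a phase \<open>z\<close> that
  makes its first entry real.\<close>

lemma eigenvector_normalized:
  fixes A :: "complex mat"
  assumes A: "A \<in> carrier_mat n n" and n: "0 < n" and e: "eigenvalue A e"
  obtains v :: "nat \<Rightarrow> complex" where "(\<Sum>i<n. (cmod (v i))\<^sup>2) = 1" "v 0 \<in> \<real>"
    "\<And>i. i < n \<Longrightarrow> (\<Sum>j<n. A $$ (i, j) * v j) = e * v i"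
proof -
  from e obtain w where w: "w \<in> carrier_vec n" "w \<noteq> 0\<^sub>v n" "A *\<^sub>v w = e \<cdot>\<^sub>v w"
    using A unfolding eigenvalue_def eigenvector_def by auto
  define N where "N = (\<Sum>i<n. (cmod (w $ i))\<^sup>2)"
  have "\<exists>i<n. w $ i \<noteq> 0" using w(1,2) by (metis carrier_vecD dim_vec eq_vecI index_zero_vec)
  hence "N \<noteq> 0" unfolding N_def by (subst sum_nonneg_eq_0_iff) auto
  moreover have "N \<ge> 0" unfolding N_def by (intro sum_nonneg) auto
  ultimately have N: "N > 0" by auto
  define z where "z = (if w $ 0 = 0 then 1 else cnj (w $ 0) / complex_of_real (cmod (w $ 0)))"
  have z: "cmod z = 1" by (simp add: z_def norm_divide)
  define v where "v i = z / complex_of_real (sqrt N) * w $ i" for i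
  have "(cmod (v i))\<^sup>2 = (cmod (w $ i))\<^sup>2 / N" for i
    using N by (simp add: v_def norm_mult norm_divide z power_divide)
  hence 1: "(\<Sum>i<n. (cmod (v i))\<^sup>2) = 1"
    using N by (simp flip: sum_divide_distrib N_def)
  have "z * w $ 0 = complex_of_real (cmod (w $ 0))"
    using complex_norm_square[of "w $ 0"]
    by (auto simp: z_def power2_eq_square field_simps)
  hence "v 0 = complex_of_real (cmod (w $ 0) / sqrt N)" by (simp add: v_def)
  hence 2: "v 0 \<in> \<real>" by (metis Reals_of_real)
  have "(\<Sum>j<n. A $$ (i, j) * v j) = e * v i" if i: "i < n" for i
  proof -
    have "(\<Sum>j<n. A $$ (i, j) * w $ j) = (A *\<^sub>v w) $ i"
      using A w(1) i by (simp add: scalar_prod_def lessThan_atLeast0)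
    also have "\<dots> = e * w $ i" using w i by simp
    finally have "z / complex_of_real (sqrt N) * (\<Sum>j<n. A $$ (i, j) * w $ j) = e * v i"
      by (simp add: v_def)
    thus ?thesis by (simp add: sum_distrib_left v_def mult_ac)
  qed
  with 1 2 show thesis by (rule that)
qed

text \<open>Deflation: after conjugation by a unitary whose first column is an eigenvector, the
  first column of the matrix is a multiple of the first basis vector, and hermiticity does the same
  for the first row. The induction treats the remaining block. Eigenvalues are a function
  \<open>s\<close> of the basis position, so multiplicities later become numbers of
  positions.\<close>

theorem hermitian_spectral_decomposition:
  assumes "hermitian_mat n A"
  obtains W s where "unitary_mat n W" "A = W * real_diag n s * mat_adjoint W"
proof -
  have "\<exists>W s. unitary_mat n W \<and> A = W * real_diag n s * mat_adjoint W"
    using assms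
  proof (induction n arbitrary: A)
    case 0
    hence A: "A \<in> carrier_mat 0 0" unfolding hermitian_mat_def by auto
    have "unitary_mat 0 A" "A = A * real_diag 0 (\<lambda>_. 0) * mat_adjoint A"
      using A unfolding unitary_mat_def by (auto intro!: eq_matI)
    thus ?case by blast
  next
    case (Suc n)
    let ?n = "Suc n"
    have A: "A \<in> carrier_mat ?n ?n" using Suc.prems by (rule hermitian_matD)
    from spectrum_non_empty[OF A] obtain e where e: "eigenvalue A e"
      unfolding spectrum_def by auto
    obtain v where v: "(\<Sum>i<?n. (cmod (v i))\<^sup>2) = 1" "v 0 \<in> \<real>"
      "\<And>i. i < ?n \<Longrightarrow> (\<Sum>j<?n. A $$ (i, j) * v j) = e * v i"
      by (rule eigenvector_normalized[OF A _ e]) auto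
    obtain Q where Q: "unitary_mat ?n Q" "\<And>i. i < ?n \<Longrightarrow> Q $$ (i, 0) = v i"
      by (rule unitary_with_first_column[OF _ v(1,2)]) auto
    note Qc = unitary_matD[OF Q(1)]
    define B where "B = mat_adjoint Q * A * Q"
    have B: "hermitian_mat ?n B"
      using hermitian_mat_conj[OF Suc.prems Qc(2)] by (simp add: B_def)
    note Bc = hermitian_matD[OF B]
    have AQ: "(A * Q) $$ (i, 0) = e * Q $$ (i, 0)" if "i < ?n" for i
      using v(3)[OF that] that A Qc Q(2)
      by (subst index_mult_mat_sum[of _ ?n ?n _ ?n]) auto
    have B0: "B $$ (i, 0) = (if i = 0 then e else 0)" if i: "i < ?n" for i
    proof -
      have "B $$ (i, 0) = (mat_adjoint Q * (A * Q)) $$ (i, 0)"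
        unfolding B_def using A Qc by (simp add: square_mult_assoc[of _ ?n])
      also have "\<dots> = (\<Sum>k<?n. mat_adjoint Q $$ (i, k) * (e * Q $$ (k, 0)))"
        using A Qc i AQ by (subst index_mult_mat_sum[of _ ?n ?n _ ?n]) (auto intro!: sum.cong)
      also have "\<dots> = e * (mat_adjoint Q * Q) $$ (i, 0)"
        using Qc i by (subst index_mult_mat_sum[of _ ?n ?n _ ?n])
          (auto simp: sum_distrib_left mult_ac simp del: sum.lessThan_Suc)
      finally show ?thesis using Qc i by simp
    qed
    have B0': "B $$ (0, i) = (if i = 0 then e else 0)" if i: "i < ?n" for i
      using B0[OF i] Bc(2)[of i 0] Bc(2)[of 0 0] B0[of 0] i by (auto split: if_splits)
    have e_real: "e = complex_of_real (Re e)"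
      using Bc(2)[of 0 0] B0[of 0] by (simp add: complex_eq_iff)
    define A' where "A' = mat n n (\<lambda>(i, j). B $$ (Suc i, Suc j))"
    have "hermitian_mat n A'" by (rule hermitian_matI) (auto simp: A'_def intro: Bc(2))
    from Suc.IH[OF this] obtain W s where W: "unitary_mat n W" "A' = W * real_diag n s * mat_adjoint W"
      by auto
    note Wc = unitary_matD[OF W(1)]
    \<comment> \<open>The direct sum of the scalar 1 and \<open>W\<close>; it leaves the eigenvector
      that was split off untouched.\<close>
    define W1 where "W1 = mat ?n ?n (\<lambda>(i, j). case i of 0 \<Rightarrow> (case j of 0 \<Rightarrow> 1 | Suc j' \<Rightarrow> 0)
       | Suc i' \<Rightarrow> (case j of 0 \<Rightarrow> 0 | Suc j' \<Rightarrow> W $$ (i', j')))"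
    have W1c: "W1 \<in> carrier_mat ?n ?n" by (simp add: W1_def)
    have W1i: "W1 $$ (0, 0) = 1" "\<And>j. j < n \<Longrightarrow> W1 $$ (0, Suc j) = 0" "\<And>i. i < n \<Longrightarrow> W1 $$ (Suc i, 0) = 0"
      "\<And>i j. i < n \<Longrightarrow> j < n \<Longrightarrow> W1 $$ (Suc i, Suc j) = W $$ (i, j)"
      by (auto simp: W1_def)
    have "W1 * mat_adjoint W1 = 1\<^sub>m ?n"
    proof (rule eq_matI)
      fix i j assume "i < dim_row (1\<^sub>m ?n :: complex mat)" "j < dim_col (1\<^sub>m ?n :: complex mat)"
      hence ij: "i < ?n" "j < ?n" by auto
      have *: "(\<Sum>x<n. W $$ (i', x) * cnj (W $$ (j', x))) = (if i' = j' then 1 else 0)"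
        if "i' < n" "j' < n" for i' j'
      proof -
        have "(W * mat_adjoint W) $$ (i', j') = (\<Sum>x<n. W $$ (i', x) * cnj (W $$ (j', x)))"
          using Wc(1,2) that by (subst index_mult_mat_sum[of _ n n _ n]) auto
        thus ?thesis using Wc that by simp
      qed
      have "(W1 * mat_adjoint W1) $$ (i, j) = (\<Sum>x<?n. W1 $$ (i, x) * cnj (W1 $$ (j, x)))"
        using W1c ij by (subst index_mult_mat_sum[of _ ?n ?n _ ?n]) auto
      also have "\<dots> = (if i = j then 1 else 0)"
        using ij by (cases i; cases j) (auto simp: sum.lessThan_Suc_shift W1i * simp del: sum.lessThan_Suc)
      finally show "(W1 * mat_adjoint W1) $$ (i, j) = 1\<^sub>m ?n $$ (i, j)" using ij by simp
    qed (use W1c in auto)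
    moreover from this have "mat_adjoint W1 * W1 = 1\<^sub>m ?n"
      using mat_mult_left_right_inverse W1c mat_adjoint_carrier by blast
    ultimately have W1: "unitary_mat ?n W1" using W1c unfolding unitary_mat_def by auto
    define s1 where "s1 = case_nat (Re e) s"
    have BW: "B = W1 * real_diag ?n s1 * mat_adjoint W1"
    proof (rule eq_matI)
      fix i j assume "i < dim_row (W1 * real_diag ?n s1 * mat_adjoint W1)"
        "j < dim_col (W1 * real_diag ?n s1 * mat_adjoint W1)"
      hence ij: "i < ?n" "j < ?n" using W1c by auto
      have *: "B $$ (Suc i', Suc j') = (\<Sum>m<n. complex_of_real (s m) * W $$ (i', m) * cnj (W $$ (j', m)))"
        if "i' < n" "j' < n" for i' j'
      proof -
        have "B $$ (Suc i', Suc j') = A' $$ (i', j')" using that by (simp add: A'_def)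
        thus ?thesis using conj_real_diag_index[OF Wc(1) that] W(2) by simp
      qed
      have "(W1 * real_diag ?n s1 * mat_adjoint W1) $$ (i, j)
          = (\<Sum>m<?n. complex_of_real (s1 m) * W1 $$ (i, m) * cnj (W1 $$ (j, m)))"
        by (rule conj_real_diag_index[OF W1c ij])
      also have "\<dots> = B $$ (i, j)"
        using ij B0 B0' e_real
        by (cases i; cases j) (auto simp: sum.lessThan_Suc_shift W1i * s1_def simp del: sum.lessThan_Suc)
      finally show "B $$ (i, j) = (W1 * real_diag ?n s1 * mat_adjoint W1) $$ (i, j)" by simp
    qed (use W1c Bc in auto)
    have "A = Q * B * mat_adjoint Q"
      unfolding B_def using unitary_conj_cancel(1)[OF Q(1) A] by simp
    also have "\<dots> = (Q * W1) * real_diag ?n s1 * mat_adjoint (Q * W1)"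
      unfolding BW using Qc W1c
      by (simp add: mat_adjoint_mult[of _ ?n ?n _ ?n] square_mult_assoc[of _ ?n])
    finally show ?case using unitary_mat_mult[OF Q(1) W1] by blast
  qed
  thus thesis using that by blast
qed

subsection \<open>Composite systems\<close>

lemma sum_product_index:
  fixes f :: "nat \<Rightarrow> 'a :: comm_monoid_add"
  shows "(\<Sum>x<a * b. f x) = (\<Sum>i<a. \<Sum>j<b. f (i * b + j))"
proof -
  have "(\<Sum>j<b. f (i * b + j)) = sum f {i * b..<i * b + b}" for i
    by (subst sum.atLeastLessThan_shift_0) (simp add: lessThan_atLeast0 add.commute)
  thus ?thesis by (simp add: sum.nat_group)
qed

lemma product_index_less:
  fixes i j a b :: nat
  assumes "i < a" "j < b"
  shows "i * b + j < a * b"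
proof -
  have "i * b + j < Suc i * b" using assms(2) by simp
  also have "\<dots> \<le> a * b" using assms(1) by (intro mult_le_mono1) simp
  finally show ?thesis .
qed

lemma product_index_div_mod [simp]:
  fixes i j b :: nat
  assumes "j < b"
  shows "(i * b + j) div b = i" "(i * b + j) mod b = j"
  using assms by auto

lemma product_index_cases:
  fixes x a b :: nat
  assumes "x < a * b"
  obtains i j where "i < a" "j < b" "x = i * b + j"
proof
  have "b > 0" using assms by (cases b) auto
  thus "x mod b < b" by simp
  show "x div b < a" using assms by (simp add: less_mult_imp_div_less)
  show "x = x div b * b + x mod b" by simp
qed

lemma product_index_eq_iff:
  fixes i j i' j' b :: nat
  assumes "j < b" "j' < b"
  shows "i * b + j = i' * b + j' \<longleftrightarrow> i = i' \<and> j = j'"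
  using assms by (metis product_index_div_mod)

lemma eq_mat_productI:
  assumes "M \<in> carrier_mat (a * b) (a * b)" "N \<in> carrier_mat (a * b) (a * b)"
    and "\<And>i k j l. i < a \<Longrightarrow> k < b \<Longrightarrow> j < a \<Longrightarrow> l < b \<Longrightarrow>
      M $$ (i * b + k, j * b + l) = N $$ (i * b + k, j * b + l)"
  shows "M = N"
proof (rule eq_matI)
  fix x y assume "x < dim_row N" "y < dim_col N"
  hence "x < a * b" "y < a * b" using assms(2) by auto
  thus "M $$ (x, y) = N $$ (x, y)"
    by (elim product_index_cases) (simp add: assms(3))
qed (use assms in auto)

lemma conj_mat_index:
  fixes A M :: "complex mat"
  assumes "A \<in> carrier_mat n n" "M \<in> carrier_mat n n" "i < n" "j < n"
  shows "(A * M * mat_adjoint A) $$ (i, j)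
    = (\<Sum>x<n. \<Sum>y<n. A $$ (i, x) * M $$ (x, y) * cnj (A $$ (j, y)))"
proof -
  have "(A * M * mat_adjoint A) $$ (i, j) = (\<Sum>y<n. (A * M) $$ (i, y) * mat_adjoint A $$ (y, j))"
    using assms by (intro index_mult_mat_sum) auto
  also have "\<dots> = (\<Sum>y<n. \<Sum>x<n. A $$ (i, x) * M $$ (x, y) * cnj (A $$ (j, y)))"
  proof (rule sum.cong)
    fix y assume "y \<in> {..<n}"
    hence y: "y < n" by simp
    have "(A * M) $$ (i, y) = (\<Sum>x<n. A $$ (i, x) * M $$ (x, y))"
      using assms y by (intro index_mult_mat_sum) auto
    thus "(A * M) $$ (i, y) * mat_adjoint A $$ (y, j)
        = (\<Sum>x<n. A $$ (i, x) * M $$ (x, y) * cnj (A $$ (j, y)))"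
      using assms y by (simp add: sum_distrib_right)
  qed simp
  also have "\<dots> = (\<Sum>x<n. \<Sum>y<n. A $$ (i, x) * M $$ (x, y) * cnj (A $$ (j, y)))"
    by (rule sum.swap)
  finally show ?thesis .
qed

lemma tensor_mat_dim [simp]:
  "dim_row (tensor_mat A B) = dim_row A * dim_row B" "dim_col (tensor_mat A B) = dim_col A * dim_col B"
  by (simp_all add: tensor_mat_def)

lemma tensor_mat_carrier [simp, intro]:
  "A \<in> carrier_mat a a \<Longrightarrow> B \<in> carrier_mat b b \<Longrightarrow> tensor_mat A B \<in> carrier_mat (a * b) (a * b)"
  unfolding tensor_mat_def by auto

lemma tensor_mat_index:
  assumes "A \<in> carrier_mat a a" "B \<in> carrier_mat b b" "i < a" "k < b" "j < a" "l < b"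
  shows "tensor_mat A B $$ (i * b + k, j * b + l) = A $$ (i, j) * B $$ (k, l)"
  using assms product_index_less[of i a k b] product_index_less[of j a l b]
  unfolding tensor_mat_def by auto

lemma tensor_mat_adjoint:
  assumes "A \<in> carrier_mat a a" "B \<in> carrier_mat b b"
  shows "mat_adjoint (tensor_mat A B) = tensor_mat (mat_adjoint A) (mat_adjoint B)"
proof (rule eq_mat_productI[of _ a b])
  fix i k j l assume ijkl: "i < a" "k < b" "j < a" "l < b"
  note T = tensor_mat_carrier[OF assms]
  show "mat_adjoint (tensor_mat A B) $$ (i * b + k, j * b + l)
      = tensor_mat (mat_adjoint A) (mat_adjoint B) $$ (i * b + k, j * b + l)"
    using assms ijkl T product_index_less[of i a k b] product_index_less[of j a l b]
    by (subst mat_adjoint_index) (auto simp: tensor_mat_index[of _ a _ b])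
qed (use assms in auto)

lemma tensor_mat_mult:
  assumes "A \<in> carrier_mat a a" "B \<in> carrier_mat b b" "C \<in> carrier_mat a a" "D \<in> carrier_mat b b"
  shows "tensor_mat A B * tensor_mat C D = tensor_mat (A * C) (B * D)"
proof (rule eq_mat_productI[of _ a b])
  fix i k j l assume ijkl: "i < a" "k < b" "j < a" "l < b"
  have "(tensor_mat A B * tensor_mat C D) $$ (i * b + k, j * b + l)
      = (\<Sum>x<a * b. tensor_mat A B $$ (i * b + k, x) * tensor_mat C D $$ (x, j * b + l))"
    using assms ijkl by (intro index_mult_mat_sum) (auto intro: product_index_less)
  also have "\<dots> = (\<Sum>x<a. \<Sum>y<b. (A $$ (i, x) * C $$ (x, j)) * (B $$ (k, y) * D $$ (y, l)))"
    unfolding sum_product_index using assms ijkl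
    by (intro sum.cong) (auto simp: tensor_mat_index[of _ a _ b])
  also have "\<dots> = (A * C) $$ (i, j) * (B * D) $$ (k, l)"
    using assms ijkl
    by (simp add: index_mult_mat_sum[of _ a a _ a] index_mult_mat_sum[of _ b b _ b] sum_product
        del: index_mult_mat)
  also have "\<dots> = tensor_mat (A * C) (B * D) $$ (i * b + k, j * b + l)"
    using assms ijkl by (intro tensor_mat_index[symmetric]) auto
  finally show "(tensor_mat A B * tensor_mat C D) $$ (i * b + k, j * b + l)
    = tensor_mat (A * C) (B * D) $$ (i * b + k, j * b + l)" .
qed (use assms in auto)

lemma tensor_mat_one: "tensor_mat (1\<^sub>m a) (1\<^sub>m b) = 1\<^sub>m (a * b)"
  by (rule eq_mat_productI[of _ a b])
    (auto simp: tensor_mat_index[of _ a _ b] product_index_less product_index_eq_iff)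

lemma one_adjoint [simp]: "mat_adjoint (1\<^sub>m n) = (1\<^sub>m n :: complex mat)"
  by (rule eq_matI) auto

lemma unitary_tensor_one:
  assumes "unitary_mat b V"
  shows "unitary_mat (a * b) (tensor_mat (1\<^sub>m a) V)"
  using unitary_matD[OF assms] unfolding unitary_mat_def
  by (simp add: tensor_mat_adjoint[of _ a _ b] tensor_mat_mult[of _ a _ b] tensor_mat_one)

text \<open>\<open>V\<close> is an arbitrary square matrix because the formula serves twice: for
  changes of basis on the catalyst, and for Kraus matrices acting next to a reference
  system.\<close>

lemma local_conj_index:
  assumes "V \<in> carrier_mat b b" "M \<in> carrier_mat (a * b) (a * b)" "i < a" "k < b" "j < a" "l < b"
  shows "(tensor_mat (1\<^sub>m a) V * M * mat_adjoint (tensor_mat (1\<^sub>m a) V)) $$ (i * b + k, j * b + l)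
    = (\<Sum>x<b. \<Sum>y<b. V $$ (k, x) * M $$ (i * b + x, j * b + y) * cnj (V $$ (l, y)))"
proof -
  have "(tensor_mat (1\<^sub>m a) V * M * mat_adjoint (tensor_mat (1\<^sub>m a) V)) $$ (i * b + k, j * b + l)
    = (\<Sum>i'<a. \<Sum>x<b. \<Sum>j'<a. \<Sum>y<b. tensor_mat (1\<^sub>m a) V $$ (i * b + k, i' * b + x) * M $$ (i' * b + x, j' * b + y)
        * cnj (tensor_mat (1\<^sub>m a) V $$ (j * b + l, j' * b + y)))"
    using assms by (subst conj_mat_index[of _ "a * b"]) (auto intro: product_index_less simp: sum_product_index)
  also have "\<dots> = (\<Sum>i'<a. \<Sum>x<b. \<Sum>j'<a. \<Sum>y<b. if i' = i then if j' = j then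
      V $$ (k, x) * M $$ (i * b + x, j * b + y) * cnj (V $$ (l, y)) else 0 else 0)"
    using assms by (intro sum.cong refl) (simp add: tensor_mat_index[of _ a _ b])
  also have "\<dots> = (\<Sum>i'<a. \<Sum>x<b. if i' = i then \<Sum>y<b.
      V $$ (k, x) * M $$ (i * b + x, j * b + y) * cnj (V $$ (l, y)) else 0)"
    by (intro sum.cong refl, subst sum.swap) (use assms in auto)
  also have "\<dots> = (\<Sum>x<b. \<Sum>y<b. V $$ (k, x) * M $$ (i * b + x, j * b + y) * cnj (V $$ (l, y)))"
    by (subst sum.swap) (use assms in auto)
  finally show ?thesis .
qed

section \<open>Partial traces, and unitaries on the discarded factor\<close>

lemma trace_fst_carrier [simp, intro]: "trace_fst a b M \<in> carrier_mat b b"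
  by (simp add: trace_fst_def)

lemma trace_snd_carrier [simp, intro]: "trace_snd a b M \<in> carrier_mat a a"
  by (simp add: trace_snd_def)

lemma partial_trace_dim [simp]:
  "dim_row (trace_fst a b M) = b" "dim_col (trace_fst a b M) = b"
  "dim_row (trace_snd a b M) = a" "dim_col (trace_snd a b M) = a"
  by (simp_all add: trace_fst_def trace_snd_def)

lemma trace_fst_index:
  "k < b \<Longrightarrow> l < b \<Longrightarrow> trace_fst a b M $$ (k, l) = (\<Sum>i<a. M $$ (i * b + k, i * b + l))"
  by (simp add: trace_fst_def)

lemma trace_snd_index:
  "i < a \<Longrightarrow> j < a \<Longrightarrow> trace_snd a b M $$ (i, j) = (\<Sum>k<b. M $$ (i * b + k, j * b + k))"
  by (simp add: trace_snd_def)

lemma trace_fst_local_conj: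
  assumes "V \<in> carrier_mat b b" "M \<in> carrier_mat (a * b) (a * b)"
  shows "trace_fst a b (tensor_mat (1\<^sub>m a) V * M * mat_adjoint (tensor_mat (1\<^sub>m a) V))
    = V * trace_fst a b M * mat_adjoint V"
proof (rule eq_matI)
  fix k l assume "k < dim_row (V * trace_fst a b M * mat_adjoint V)"
    "l < dim_col (V * trace_fst a b M * mat_adjoint V)"
  hence kl: "k < b" "l < b" using assms by auto
  have "trace_fst a b (tensor_mat (1\<^sub>m a) V * M * mat_adjoint (tensor_mat (1\<^sub>m a) V)) $$ (k, l)
    = (\<Sum>i<a. \<Sum>x<b. \<Sum>y<b. V $$ (k, x) * M $$ (i * b + x, i * b + y) * cnj (V $$ (l, y)))"
    unfolding trace_fst_index[OF kl] using kl assms by (intro sum.cong refl local_conj_index) auto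
  also have "\<dots> = (\<Sum>x<b. \<Sum>i<a. \<Sum>y<b. V $$ (k, x) * M $$ (i * b + x, i * b + y) * cnj (V $$ (l, y)))"
    by (rule sum.swap)
  also have "\<dots> = (\<Sum>x<b. \<Sum>y<b. \<Sum>i<a. V $$ (k, x) * M $$ (i * b + x, i * b + y) * cnj (V $$ (l, y)))"
    by (intro sum.cong refl sum.swap)
  also have "\<dots> = (\<Sum>x<b. \<Sum>y<b. V $$ (k, x) * trace_fst a b M $$ (x, y) * cnj (V $$ (l, y)))"
    by (intro sum.cong refl) (simp add: trace_fst_index sum_distrib_left sum_distrib_right)
  also have "\<dots> = (V * trace_fst a b M * mat_adjoint V) $$ (k, l)"
    using assms kl by (intro conj_mat_index[symmetric]) auto
  finally show "trace_fst a b (tensor_mat (1\<^sub>m a) V * M * mat_adjoint (tensor_mat (1\<^sub>m a) V)) $$ (k, l)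
    = (V * trace_fst a b M * mat_adjoint V) $$ (k, l)" .
qed (use assms in auto)

text \<open>What happens locally to the discarded factor is invisible, since the columns of
  \<open>V\<close> are orthonormal. Hence the catalyst can be rotated before it is traced out
  without altering the induced map on the system.\<close>

lemma trace_snd_local_conj:
  assumes "unitary_mat b V" "M \<in> carrier_mat (a * b) (a * b)"
  shows "trace_snd a b (tensor_mat (1\<^sub>m a) V * M * mat_adjoint (tensor_mat (1\<^sub>m a) V)) = trace_snd a b M"
proof (rule eq_matI)
  fix i j assume "i < dim_row (trace_snd a b M)" "j < dim_col (trace_snd a b M)"
  hence ij: "i < a" "j < a" by (auto simp: trace_snd_def)
  note V = unitary_matD[OF assms(1)]
  have orth: "(\<Sum>k<b. V $$ (k, x) * cnj (V $$ (k, y))) = (if x = y then 1 else 0)"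
    if "x < b" "y < b" for x y
  proof -
    have "(\<Sum>k<b. V $$ (k, x) * cnj (V $$ (k, y))) = (mat_adjoint V * V) $$ (y, x)"
      using V(1,2) that by (subst index_mult_mat_sum[of _ b b _ b]) (auto simp: mult.commute)
    thus ?thesis using V(3) that by auto
  qed
  have "trace_snd a b (tensor_mat (1\<^sub>m a) V * M * mat_adjoint (tensor_mat (1\<^sub>m a) V)) $$ (i, j)
    = (\<Sum>k<b. \<Sum>x<b. \<Sum>y<b. V $$ (k, x) * M $$ (i * b + x, j * b + y) * cnj (V $$ (k, y)))"
    unfolding trace_snd_index[OF ij] using ij assms V by (intro sum.cong refl local_conj_index) auto
  also have "\<dots> = (\<Sum>x<b. \<Sum>k<b. \<Sum>y<b. V $$ (k, x) * M $$ (i * b + x, j * b + y) * cnj (V $$ (k, y)))"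
    by (rule sum.swap)
  also have "\<dots> = (\<Sum>x<b. \<Sum>y<b. \<Sum>k<b. V $$ (k, x) * M $$ (i * b + x, j * b + y) * cnj (V $$ (k, y)))"
    by (intro sum.cong refl sum.swap)
  also have "\<dots> = (\<Sum>x<b. \<Sum>y<b. M $$ (i * b + x, j * b + y) * (\<Sum>k<b. V $$ (k, x) * cnj (V $$ (k, y))))"
    by (intro sum.cong refl) (simp add: sum_distrib_left mult_ac)
  also have "\<dots> = (\<Sum>x<b. \<Sum>y<b. if y = x then M $$ (i * b + x, j * b + y) else 0)"
    by (intro sum.cong refl) (simp add: orth)
  also have "\<dots> = trace_snd a b M $$ (i, j)" using ij by (simp add: trace_snd_index)
  finally show "trace_snd a b (tensor_mat (1\<^sub>m a) V * M * mat_adjoint (tensor_mat (1\<^sub>m a) V)) $$ (i, j)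
     = trace_snd a b M $$ (i, j)" .
qed (auto simp: trace_snd_def)

lemma mat_trace_sum: "A \<in> carrier_mat n n \<Longrightarrow> mat_trace A = (\<Sum>i<n. A $$ (i, i))"
  by (auto simp: mat_trace_def)

lemma mat_trace_trace_snd:
  "M \<in> carrier_mat (a * b) (a * b) \<Longrightarrow> mat_trace (trace_snd a b M) = mat_trace M"
  by (simp add: mat_trace_sum[of _ "a * b"] mat_trace_sum[of _ a] sum_product_index trace_snd_index)

lemma mat_trace_tensor:
  "A \<in> carrier_mat a a \<Longrightarrow> B \<in> carrier_mat b b \<Longrightarrow> mat_trace (tensor_mat A B) = mat_trace A * mat_trace B"
  by (simp add: mat_trace_sum[of _ "a * b"] mat_trace_sum[of _ a] mat_trace_sum[of _ b] sum_product_index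
      tensor_mat_index[of _ a _ b] sum_product)

lemma mat_trace_mult_commute:
  fixes A B :: "complex mat"
  assumes "A \<in> carrier_mat n n" "B \<in> carrier_mat n n"
  shows "mat_trace (A * B) = mat_trace (B * A)"
proof -
  have "mat_trace (A * B) = (\<Sum>i<n. \<Sum>j<n. A $$ (i, j) * B $$ (j, i))"
    using assms by (simp add: mat_trace_sum[of _ n] index_mult_mat_sum[of _ n n _ n] del: index_mult_mat)
  also have "\<dots> = (\<Sum>j<n. \<Sum>i<n. A $$ (i, j) * B $$ (j, i))" by (rule sum.swap)
  also have "\<dots> = mat_trace (B * A)"
    using assms by (simp add: mat_trace_sum[of _ n] index_mult_mat_sum[of _ n n _ n] mult.commute del: index_mult_mat)
  finally show ?thesis .
qed

lemma mat_trace_unitary_conj: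
  assumes "unitary_mat n U" "A \<in> carrier_mat n n"
  shows "mat_trace (U * A * mat_adjoint U) = mat_trace A"
proof -
  note U = unitary_matD[OF assms(1)]
  have "mat_trace (U * A * mat_adjoint U) = mat_trace (mat_adjoint U * (U * A))"
    using U assms by (intro mat_trace_mult_commute) auto
  thus ?thesis by (simp add: adjoint_mult_cancel(1)[OF assms])
qed

subsection \<open>Quadratic forms and eigenvalues\<close>

lemma cscalar_prod_sum:
  fixes v w :: "complex vec"
  assumes "v \<in> carrier_vec n" "w \<in> carrier_vec n"
  shows "v \<bullet>c w = (\<Sum>i<n. v $ i * cnj (w $ i))"
  using assms by (auto simp: scalar_prod_def lessThan_atLeast0 intro!: sum.cong)

lemma cscalar_prod_self:
  fixes v :: "complex vec"
  assumes "v \<in> carrier_vec n"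
  shows "v \<bullet>c v = complex_of_real (\<Sum>i<n. (cmod (v $ i))\<^sup>2)"
  by (subst cscalar_prod_sum[OF assms assms])
    (simp add: complex_norm_square of_real_sum del: of_real_power)

lemma mult_mat_vec_sum:
  assumes "A \<in> carrier_mat n m" "v \<in> carrier_vec m" "i < n"
  shows "(A *\<^sub>v v) $ i = (\<Sum>j<m. A $$ (i, j) * v $ j)"
  using assms by (auto simp: scalar_prod_def lessThan_atLeast0)

lemma adjoint_cscalar_prod:
  fixes A :: "complex mat"
  assumes "A \<in> carrier_mat n n" "v \<in> carrier_vec n" "w \<in> carrier_vec n"
  shows "(A *\<^sub>v v) \<bullet>c w = v \<bullet>c (mat_adjoint A *\<^sub>v w)"
proof -
  have "(A *\<^sub>v v) \<bullet>c w = (\<Sum>i<n. (A *\<^sub>v v) $ i * cnj (w $ i))"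
    using assms by (intro cscalar_prod_sum) auto
  also have "\<dots> = (\<Sum>i<n. \<Sum>j<n. A $$ (i, j) * v $ j * cnj (w $ i))"
    by (intro sum.cong refl, subst mult_mat_vec_sum[OF assms(1,2)]) (auto simp: sum_distrib_right)
  also have "\<dots> = (\<Sum>j<n. \<Sum>i<n. A $$ (i, j) * v $ j * cnj (w $ i))" by (rule sum.swap)
  also have "\<dots> = (\<Sum>j<n. v $ j * cnj ((mat_adjoint A *\<^sub>v w) $ j))"
  proof (intro sum.cong refl)
    fix j assume "j \<in> {..<n}"
    hence j: "j < n" by simp
    have "(mat_adjoint A *\<^sub>v w) $ j = (\<Sum>i<n. cnj (A $$ (i, j)) * w $ i)"
      using assms j by (subst mult_mat_vec_sum[of _ n n]) auto
    thus "(\<Sum>i<n. A $$ (i, j) * v $ j * cnj (w $ i)) = v $ j * cnj ((mat_adjoint A *\<^sub>v w) $ j)"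
      by (simp add: sum_distrib_left mult_ac)
  qed
  also have "\<dots> = v \<bullet>c (mat_adjoint A *\<^sub>v w)"
    using assms by (intro cscalar_prod_sum[symmetric] mult_mat_vec_carrier[of _ n n]) auto
  finally show ?thesis .
qed

lemma conj_form:
  fixes B M :: "complex mat"
  assumes "B \<in> carrier_mat n n" "M \<in> carrier_mat n n" "v \<in> carrier_vec n"
  shows "((B * M * mat_adjoint B) *\<^sub>v v) \<bullet>c v
    = (M *\<^sub>v (mat_adjoint B *\<^sub>v v)) \<bullet>c (mat_adjoint B *\<^sub>v v)"
proof -
  have w: "mat_adjoint B *\<^sub>v v \<in> carrier_vec n" "M *\<^sub>v (mat_adjoint B *\<^sub>v v) \<in> carrier_vec n"
    using assms by (auto intro!: mult_mat_vec_carrier[of _ n n])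
  have "(B * M * mat_adjoint B) *\<^sub>v v = B *\<^sub>v (M *\<^sub>v (mat_adjoint B *\<^sub>v v))"
    using assms w by (simp add: assoc_mult_mat_vec[of _ n n _ n])
  thus ?thesis using assms w by (simp add: adjoint_cscalar_prod[of _ n])
qed

lemma unitary_norm:
  assumes "unitary_mat n U" "v \<in> carrier_vec n"
  shows "(U *\<^sub>v v) \<bullet>c (U *\<^sub>v v) = v \<bullet>c v"
proof -
  note U = unitary_matD[OF assms(1)]
  have "(U *\<^sub>v v) \<bullet>c (U *\<^sub>v v) = v \<bullet>c (mat_adjoint U *\<^sub>v (U *\<^sub>v v))"
    using U assms by (intro adjoint_cscalar_prod mult_mat_vec_carrier[of _ n n]) auto
  also have "mat_adjoint U *\<^sub>v (U *\<^sub>v v) = (mat_adjoint U * U) *\<^sub>v v"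
    using U assms by (intro assoc_mult_mat_vec[symmetric]) auto
  finally show ?thesis using U assms by simp
qed

lemma form_sum:
  fixes N :: "complex mat"
  assumes "N \<in> carrier_mat n n" "\<And>l. l \<in> S \<Longrightarrow> B l \<in> carrier_mat n n" "v \<in> carrier_vec n"
    and "\<And>i j. i < n \<Longrightarrow> j < n \<Longrightarrow> N $$ (i, j) = (\<Sum>l\<in>S. c l * B l $$ (i, j))"
  shows "(N *\<^sub>v v) \<bullet>c v = (\<Sum>l\<in>S. c l * ((B l *\<^sub>v v) \<bullet>c v))"
proof -
  have form: "(A *\<^sub>v v) \<bullet>c v = (\<Sum>i<n. \<Sum>j<n. A $$ (i, j) * (v $ j * cnj (v $ i)))"
    if "A \<in> carrier_mat n n" for A
  proof -
    have "(A *\<^sub>v v) \<bullet>c v = (\<Sum>i<n. (A *\<^sub>v v) $ i * cnj (v $ i))"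
      using that assms(3) by (intro cscalar_prod_sum) auto
    also have "\<dots> = (\<Sum>i<n. \<Sum>j<n. A $$ (i, j) * (v $ j * cnj (v $ i)))"
      by (intro sum.cong refl, subst mult_mat_vec_sum[OF that assms(3)]) (auto simp: sum_distrib_right mult.assoc)
    finally show ?thesis .
  qed
  have "(N *\<^sub>v v) \<bullet>c v = (\<Sum>i<n. \<Sum>j<n. \<Sum>l\<in>S. c l * (B l $$ (i, j) * (v $ j * cnj (v $ i))))"
    unfolding form[OF assms(1)] by (intro sum.cong refl) (simp add: assms(4) sum_distrib_right mult.assoc)
  also have "\<dots> = (\<Sum>i<n. \<Sum>l\<in>S. \<Sum>j<n. c l * (B l $$ (i, j) * (v $ j * cnj (v $ i))))"
    by (intro sum.cong refl sum.swap)
  also have "\<dots> = (\<Sum>l\<in>S. \<Sum>i<n. \<Sum>j<n. c l * (B l $$ (i, j) * (v $ j * cnj (v $ i))))"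
    by (rule sum.swap)
  also have "\<dots> = (\<Sum>l\<in>S. c l * ((B l *\<^sub>v v) \<bullet>c v))"
    by (intro sum.cong refl) (simp add: form[OF assms(2)] sum_distrib_left)
  finally show ?thesis .
qed

section \<open>Positive matrices and Rayleigh quotients\<close>

lemma positive_matD:
  assumes "positive_mat n M"
  shows "M \<in> carrier_mat n n" "hermitian_mat n M" "\<And>v. v \<in> carrier_vec n \<Longrightarrow> 0 \<le> Re ((M *\<^sub>v v) \<bullet>c v)"
  using assms unfolding positive_mat_def hermitian_mat_def by auto

lemma positive_mat_conj:
  assumes "positive_mat n M" "B \<in> carrier_mat n n"
  shows "positive_mat n (B * M * mat_adjoint B)"
  unfolding positive_mat_def
proof (intro conjI ballI)
  note M = positive_matD[OF assms(1)]
  show "hermitian_mat n (B * M * mat_adjoint B)" by (rule hermitian_mat_conj[OF M(2) assms(2)])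
  fix v :: "complex vec" assume v: "v \<in> carrier_vec n"
  show "0 \<le> Re (((B * M * mat_adjoint B) *\<^sub>v v) \<bullet>c v)"
    unfolding conj_form[OF assms(2) M(1) v] using assms(2) v
    by (intro M(3) mult_mat_vec_carrier[of _ n n]) auto
qed

lemma positive_mat_sum:
  fixes c :: "'a \<Rightarrow> real"
  assumes "N \<in> carrier_mat n n" "\<And>l. l \<in> S \<Longrightarrow> positive_mat n (B l)" "\<And>l. l \<in> S \<Longrightarrow> 0 \<le> c l"
    and "\<And>i j. i < n \<Longrightarrow> j < n \<Longrightarrow> N $$ (i, j) = (\<Sum>l\<in>S. complex_of_real (c l) * B l $$ (i, j))"
  shows "positive_mat n N"
  unfolding positive_mat_def
proof (intro conjI ballI)
  note B = positive_matD[OF assms(2)]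
  show "hermitian_mat n N"
  proof (rule hermitian_matI[OF assms(1)])
    fix i j assume ij: "i < n" "j < n"
    have "B l $$ (j, i) = cnj (B l $$ (i, j))" if "l \<in> S" for l
      using hermitian_matD(2)[OF B(2)[OF that] ij] .
    thus "N $$ (j, i) = cnj (N $$ (i, j))" using ij by (simp add: assms(4))
  qed
  fix v :: "complex vec" assume v: "v \<in> carrier_vec n"
  have "(N *\<^sub>v v) \<bullet>c v = (\<Sum>l\<in>S. complex_of_real (c l) * ((B l *\<^sub>v v) \<bullet>c v))"
    by (rule form_sum[OF assms(1) B(1) v assms(4)])
  hence "Re ((N *\<^sub>v v) \<bullet>c v) = (\<Sum>l\<in>S. c l * Re ((B l *\<^sub>v v) \<bullet>c v))" by simp
  thus "0 \<le> Re ((N *\<^sub>v v) \<bullet>c v)" using B(3)[OF _ v] assms(3) by (auto intro!: sum_nonneg)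
qed

lemma real_diag_mult_vec_index:
  assumes "v \<in> carrier_vec n" "i < n"
  shows "(real_diag n s *\<^sub>v v) $ i = complex_of_real (s i) * v $ i"
proof -
  have "(real_diag n s *\<^sub>v v) $ i = (\<Sum>j<n. real_diag n s $$ (i, j) * v $ j)"
    by (rule mult_mat_vec_sum[OF real_diag_carrier assms])
  also have "\<dots> = (\<Sum>j<n. if j = i then complex_of_real (s j) * v $ j else 0)"
    using assms by (intro sum.cong) auto
  finally show ?thesis using assms by simp
qed

lemma real_diag_form:
  assumes "v \<in> carrier_vec n"
  shows "Re ((real_diag n s *\<^sub>v v) \<bullet>c v) = (\<Sum>i<n. s i * (cmod (v $ i))\<^sup>2)"
proof -
  have "(real_diag n s *\<^sub>v v) \<bullet>c v = (\<Sum>i<n. complex_of_real (s i * (cmod (v $ i))\<^sup>2))"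
    using assms
    by (subst cscalar_prod_sum[of _ n]) (auto simp: real_diag_mult_vec_index complex_norm_square mult.assoc
        simp del: of_real_power index_mult_mat_vec intro!: mult_mat_vec_carrier[of _ n n])
  thus ?thesis by simp
qed

lemma positive_real_diag:
  assumes "\<And>i. i < n \<Longrightarrow> 0 \<le> s i"
  shows "positive_mat n (real_diag n s)"
  unfolding positive_mat_def using assms
  by (auto simp: real_diag_form intro!: hermitian_matI sum_nonneg)

lemma mat_trace_real_diag: "mat_trace (real_diag n s) = complex_of_real (\<Sum>i<n. s i)"
  by (simp add: mat_trace_sum[of _ n])

lemma spectrum_conj_real_diag:
  assumes "unitary_mat n W"
  shows "spectrum (W * real_diag n s * mat_adjoint W) = (\<lambda>m. complex_of_real (s m)) ` {..<n}"
proof -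
  note W = unitary_matD[OF assms]
  let ?A = "W * real_diag n s * mat_adjoint W"
  have A: "?A \<in> carrier_mat n n" using W by simp
  have "similar_mat ?A (real_diag n s)"
    by (rule similar_matI[of _ _ W "mat_adjoint W" n]) (use W in auto)
  hence "char_poly ?A = char_poly (real_diag n s)" by (rule char_poly_similar)
  also have "\<dots> = (\<Prod>a\<leftarrow>diag_mat (real_diag n s). [:- a, 1:])"
    by (rule char_poly_upper_triangular[OF real_diag_carrier]) (auto simp: upper_triangular_def real_diag_def)
  finally have cp: "char_poly ?A = (\<Prod>a\<leftarrow>diag_mat (real_diag n s). [:- a, 1:])" .
  have "poly (char_poly ?A) x = 0 \<longleftrightarrow> x \<in> set (diag_mat (real_diag n s))" for x
    unfolding cp by (auto simp: poly_prod_list prod_list_zero_iff image_iff)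
  moreover have "set (diag_mat (real_diag n s)) = (\<lambda>m. complex_of_real (s m)) ` {..<n}"
    by (auto simp: diag_mat_def real_diag_def)
  ultimately show ?thesis unfolding spectrum_root_char_poly[OF A] by auto
qed

lemma Re_spectrum_conj_real_diag:
  assumes "unitary_mat n W"
  shows "Re ` spectrum (W * real_diag n s * mat_adjoint W) = s ` {..<n}"
  unfolding spectrum_conj_real_diag[OF assms] by (auto simp: image_image)

text \<open>In an eigenbasis the form is a sum of eigenvalues weighted by squared coordinates, whose
  total is the squared norm. Keeping that norm as a factor admits unnormalized test vectors.\<close>

lemma rayleigh_le_largest_eigenvalue:
  assumes "hermitian_mat n A" "v \<in> carrier_vec n"
  shows "Re ((A *\<^sub>v v) \<bullet>c v) \<le> largest_eigenvalue A * Re (v \<bullet>c v)"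
proof -
  obtain W s where W: "unitary_mat n W" "A = W * real_diag n s * mat_adjoint W"
    by (rule hermitian_spectral_decomposition[OF assms(1)])
  note Wc = unitary_matD[OF W(1)]
  let ?w = "mat_adjoint W *\<^sub>v v"
  have w: "?w \<in> carrier_vec n" using Wc assms(2) by (intro mult_mat_vec_carrier[of _ n n]) auto
  have s: "s i \<le> largest_eigenvalue A" if "i < n" for i
    unfolding largest_eigenvalue_def W(2) Re_spectrum_conj_real_diag[OF W(1)]
    using that by (intro Max_ge) auto
  have "Re ((A *\<^sub>v v) \<bullet>c v) = (\<Sum>i<n. s i * (cmod (?w $ i))\<^sup>2)"
    unfolding W(2) conj_form[OF Wc(1) real_diag_carrier assms(2)] by (rule real_diag_form[OF w])
  also have "\<dots> \<le> (\<Sum>i<n. largest_eigenvalue A * (cmod (?w $ i))\<^sup>2)"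
    using s by (intro sum_mono mult_right_mono) auto
  also have "\<dots> = largest_eigenvalue A * Re (?w \<bullet>c ?w)"
    by (simp add: cscalar_prod_self[OF w] sum_distrib_left)
  also have "?w \<bullet>c ?w = v \<bullet>c v" by (rule unitary_norm[OF unitary_mat_adjoint[OF W(1)] assms(2)])
  finally show ?thesis .
qed

lemma largest_eigenvalue_in_spectrum:
  assumes "hermitian_mat n A" "0 < n"
  shows "eigenvalue A (complex_of_real (largest_eigenvalue A))"
proof -
  obtain W s where W: "unitary_mat n W" "A = W * real_diag n s * mat_adjoint W"
    by (rule hermitian_spectral_decomposition[OF assms(1)])
  have "Max (s ` {..<n}) \<in> s ` {..<n}" using assms(2) by (intro Max_in) auto
  hence "complex_of_real (largest_eigenvalue A) \<in> spectrum A"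
    unfolding largest_eigenvalue_def W(2) Re_spectrum_conj_real_diag[OF W(1)]
    by (auto simp: spectrum_conj_real_diag[OF W(1)])
  thus ?thesis by (simp add: spectrum_def)
qed

section \<open>Density matrices: spectral form, and why they determine linear maps\<close>

lemma quantum_stateD:
  assumes "quantum_state n \<rho>"
  shows "\<rho> \<in> carrier_mat n n" "hermitian_mat n \<rho>" "positive_mat n \<rho>" "mat_trace \<rho> = 1" "0 < n"
proof -
  show *: "\<rho> \<in> carrier_mat n n" "hermitian_mat n \<rho>" "positive_mat n \<rho>" "mat_trace \<rho> = 1"
    using assms positive_matD unfolding quantum_state_def by auto
  show "0 < n" using *(1,4) by (cases n) (auto simp: mat_trace_sum[of _ 0])
qed

lemma quantum_state_spectral:
  assumes "quantum_state n \<rho>"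
  obtains W s where "unitary_mat n W" "\<rho> = W * real_diag n s * mat_adjoint W"
    "\<And>m. m < n \<Longrightarrow> 0 \<le> s m" "(\<Sum>m<n. s m) = 1"
proof -
  note \<rho> = quantum_stateD[OF assms]
  obtain W s where W: "unitary_mat n W" "\<rho> = W * real_diag n s * mat_adjoint W"
    by (rule hermitian_spectral_decomposition[OF \<rho>(2)])
  note Wc = unitary_matD[OF W(1)]
  have "mat_adjoint W * \<rho> * W = real_diag n s"
    unfolding W(2) by (rule unitary_conj_cancel(2)[OF W(1)]) simp
  hence pos: "positive_mat n (real_diag n s)"
    using positive_mat_conj[OF \<rho>(3) Wc(2)] by simp
  have "0 \<le> s m" if m: "m < n" for m
  proof -
    have "0 \<le> Re ((real_diag n s *\<^sub>v unit_vec n m) \<bullet>c unit_vec n m)"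
      by (rule positive_matD(3)[OF pos]) simp
    also have "\<dots> = (\<Sum>i<n. if i = m then s i else 0)"
      unfolding real_diag_form[OF unit_vec_carrier] using m by (intro sum.cong) auto
    finally show ?thesis using m by simp
  qed
  moreover have "(\<Sum>m<n. s m) = 1"
  proof -
    have "complex_of_real (\<Sum>m<n. s m) = 1"
      using \<rho>(4) unfolding W(2) mat_trace_unitary_conj[OF W(1) real_diag_carrier] mat_trace_real_diag .
    thus ?thesis by (metis of_real_eq_1_iff)
  qed
  ultimately show thesis by (rule that[OF W])
qed

lemma quantum_state_spectralI:
  assumes "unitary_mat n W" "\<And>m. m < n \<Longrightarrow> 0 \<le> s m" "(\<Sum>m<n. s m) = 1"
  shows "quantum_state n (W * real_diag n s * mat_adjoint W)"
  unfolding quantum_state_def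
  using positive_mat_conj[OF positive_real_diag[OF assms(2)] unitary_matD(1)[OF assms(1)]] assms(3)
  by (simp add: mat_trace_unitary_conj[OF assms(1)] mat_trace_real_diag)

text \<open>Otherwise no eigenvalue would be positive and the trace could not be 1. This keeps every
  logarithm in \<open>min_entropy\<close> away from its default values.\<close>

lemma quantum_state_largest_eigenvalue_pos:
  assumes "quantum_state n \<rho>"
  shows "0 < largest_eigenvalue \<rho>"
proof (rule ccontr)
  assume *: "\<not> 0 < largest_eigenvalue \<rho>"
  obtain W s where W: "unitary_mat n W" "\<rho> = W * real_diag n s * mat_adjoint W"
    "\<And>m. m < n \<Longrightarrow> 0 \<le> s m" "(\<Sum>m<n. s m) = 1"
    by (rule quantum_state_spectral[OF assms]) blast
  have "s m \<le> 0" if "m < n" for m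
  proof -
    have "s m \<le> largest_eigenvalue \<rho>"
      unfolding largest_eigenvalue_def W(2) Re_spectrum_conj_real_diag[OF W(1)]
      using that by (intro Max_ge) auto
    with * show ?thesis by simp
  qed
  hence "(\<Sum>m<n. s m) \<le> 0" by (intro sum_nonpos) auto
  with W(4) show False by simp
qed

text \<open>States span all matrices over the complex numbers: a matrix is a combination of two
  Hermitian ones, and a Hermitian matrix is a difference of two positive multiples of states with
  the same eigenbasis. The result carries the identity between \<open>\<Phi>\<close> and its
  dilation from states to the off-diagonal blocks that occur in
  \<open>id_tensor_map\<close>.\<close>

lemma linear_maps_eqI:
  fixes F F' :: "complex mat \<Rightarrow> complex mat"
  assumes d: "0 < d"
    and add: "\<And>X Y. X \<in> carrier_mat d d \<Longrightarrow> Y \<in> carrier_mat d d \<Longrightarrow> F (X + Y) = F X + F Y"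
      "\<And>X Y. X \<in> carrier_mat d d \<Longrightarrow> Y \<in> carrier_mat d d \<Longrightarrow> F' (X + Y) = F' X + F' Y"
    and smult: "\<And>c X. X \<in> carrier_mat d d \<Longrightarrow> F (c \<cdot>\<^sub>m X) = c \<cdot>\<^sub>m F X"
      "\<And>c X. X \<in> carrier_mat d d \<Longrightarrow> F' (c \<cdot>\<^sub>m X) = c \<cdot>\<^sub>m F' X"
    and states: "\<And>\<rho>. quantum_state d \<rho> \<Longrightarrow> F \<rho> = F' \<rho>"
    and X: "X \<in> carrier_mat d d"
  shows "F X = F' X"
proof -
  have diag: "F (W * real_diag d s * mat_adjoint W) = F' (W * real_diag d s * mat_adjoint W)"
    if W: "unitary_mat d W" and s: "\<And>m. m < d \<Longrightarrow> 0 < s m" for W s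
  proof -
    note Wc = unitary_matD[OF W]
    define t where "t = (\<Sum>m<d. s m)"
    have t: "t > 0" unfolding t_def using s d by (intro sum_pos) auto
    let ?\<rho> = "W * real_diag d (\<lambda>m. s m / t) * mat_adjoint W"
    have st: "quantum_state d ?\<rho>"
      using s t by (intro quantum_state_spectralI[OF W])
        (auto simp: less_imp_le t_def[symmetric] simp flip: sum_divide_distrib)
    have "W * real_diag d s * mat_adjoint W = complex_of_real t \<cdot>\<^sub>m ?\<rho>"
    proof (rule eq_matI)
      fix i j assume "i < dim_row (complex_of_real t \<cdot>\<^sub>m ?\<rho>)" "j < dim_col (complex_of_real t \<cdot>\<^sub>m ?\<rho>)"
      hence ij: "i < d" "j < d" using Wc by auto
      have "?\<rho> \<in> carrier_mat d d" using Wc by simp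
      thus "(W * real_diag d s * mat_adjoint W) $$ (i, j) = (complex_of_real t \<cdot>\<^sub>m ?\<rho>) $$ (i, j)"
        using ij t by (simp add: conj_real_diag_index[OF Wc(1) ij] sum_distrib_left del: index_mult_mat)
    qed (use Wc in auto)
    moreover have "?\<rho> \<in> carrier_mat d d" using Wc by simp
    ultimately show ?thesis using smult[of ?\<rho>] states[OF st] by simp
  qed
  have herm: "F H = F' H" if H: "hermitian_mat d H" for H
  proof -
    obtain W s where W: "unitary_mat d W" "H = W * real_diag d s * mat_adjoint W"
      by (rule hermitian_spectral_decomposition[OF H])
    note Wc = unitary_matD[OF W(1)]
    \<comment> \<open>A shift larger than every eigenvalue in absolute value, so that
      \<open>?P\<close> and \<open>?C\<close> both have strictly positive spectrum and can be
      normalized to states.\<close>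
    define c where "c = 1 + (\<Sum>m<d. \<bar>s m\<bar>)"
    have sc: "0 < s m + c" if "m < d" for m
    proof -
      have "\<bar>s m\<bar> \<le> (\<Sum>m<d. \<bar>s m\<bar>)" using that by (intro member_le_sum) auto
      thus ?thesis by (simp add: c_def)
    qed
    have c: "0 < c" unfolding c_def by (intro add_pos_nonneg sum_nonneg) auto
    let ?P = "W * real_diag d (\<lambda>m. s m + c) * mat_adjoint W"
    let ?C = "W * real_diag d (\<lambda>m. c) * mat_adjoint W"
    have "H = ?P + (-1) \<cdot>\<^sub>m ?C"
    proof (rule eq_matI)
      fix i j assume "i < dim_row (?P + (-1) \<cdot>\<^sub>m ?C)" "j < dim_col (?P + (-1) \<cdot>\<^sub>m ?C)"
      hence ij: "i < d" "j < d" using Wc by auto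
      have "?P \<in> carrier_mat d d" "?C \<in> carrier_mat d d" using Wc by auto
      thus "H $$ (i, j) = (?P + (-1) \<cdot>\<^sub>m ?C) $$ (i, j)"
        unfolding W(2) using ij
        by (simp add: conj_real_diag_index[OF Wc(1) ij] algebra_simps sum.distrib del: index_mult_mat)
    qed (use Wc H in \<open>auto simp: hermitian_mat_def\<close>)
    moreover have "?P \<in> carrier_mat d d" "?C \<in> carrier_mat d d" using Wc by auto
    ultimately show ?thesis
      using add[of ?P "(-1) \<cdot>\<^sub>m ?C"] smult[of ?C "-1"] diag[OF W(1) sc] diag[OF W(1), of "\<lambda>_. c"] c
      by simp
  qed
  \<comment> \<open>The Cartesian decomposition: real and imaginary part of
    \<open>X\<close>.\<close>
  let ?R = "(1/2) \<cdot>\<^sub>m (X + mat_adjoint X)" and ?J = "(-\<i>/2) \<cdot>\<^sub>m (X - mat_adjoint X)"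
  have "hermitian_mat d ?R" "hermitian_mat d ?J"
    using X by (auto intro!: hermitian_matI simp: algebra_simps)
  moreover have "X = ?R + \<i> \<cdot>\<^sub>m ?J"
    using X by (auto intro!: eq_matI simp: algebra_simps)
  moreover have "?R \<in> carrier_mat d d" "?J \<in> carrier_mat d d" using X by auto
  ultimately show ?thesis
    using add[of ?R "\<i> \<cdot>\<^sub>m ?J"] smult[of ?J \<i>] herm[of ?R] herm[of ?J] by simp
qed

subsection \<open>Maps given by a unitary dilation\<close>

definition dilated_map :: "nat \<Rightarrow> nat \<Rightarrow> complex mat \<Rightarrow> complex mat \<Rightarrow> complex mat \<Rightarrow> complex mat" where
  "dilated_map a b G D X = trace_snd a b (G * tensor_mat X D * mat_adjoint G)"

text \<open>The operator \<open><l| G |m>\<close> on the system, for catalyst basis state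
  \<open>m\<close> before and \<open>l\<close> after the evolution.\<close>

definition kraus_mat :: "nat \<Rightarrow> nat \<Rightarrow> complex mat \<Rightarrow> nat \<Rightarrow> nat \<Rightarrow> complex mat" where
  "kraus_mat a b G l m = mat a a (\<lambda>(i, x). G $$ (i * b + l, x * b + m))"

lemma kraus_mat_carrier [simp, intro]: "kraus_mat a b G l m \<in> carrier_mat a a"
  by (simp add: kraus_mat_def)

lemma kraus_mat_index [simp]:
  "i < a \<Longrightarrow> x < a \<Longrightarrow> kraus_mat a b G l m $$ (i, x) = G $$ (i * b + l, x * b + m)"
  by (simp add: kraus_mat_def)

lemma dilation_index:
  assumes "G \<in> carrier_mat (a * b) (a * b)" "X \<in> carrier_mat a a" "p < a * b" "q < a * b"
  shows "(G * tensor_mat X (real_diag b s) * mat_adjoint G) $$ (p, q)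
    = (\<Sum>m<b. \<Sum>x<a. \<Sum>y<a. complex_of_real (s m) * (G $$ (p, x * b + m) * X $$ (x, y) * cnj (G $$ (q, y * b + m))))"
proof -
  have "(G * tensor_mat X (real_diag b s) * mat_adjoint G) $$ (p, q)
    = (\<Sum>x<a. \<Sum>m<b. \<Sum>y<a. \<Sum>m'<b. G $$ (p, x * b + m) * tensor_mat X (real_diag b s) $$ (x * b + m, y * b + m')
        * cnj (G $$ (q, y * b + m')))"
    using assms by (subst conj_mat_index[of _ "a * b"]) (auto simp: sum_product_index)
  also have "\<dots> = (\<Sum>x<a. \<Sum>m<b. \<Sum>y<a. \<Sum>m'<b. if m' = m then
      complex_of_real (s m) * (G $$ (p, x * b + m) * X $$ (x, y) * cnj (G $$ (q, y * b + m))) else 0)"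
    using assms by (intro sum.cong refl) (simp add: tensor_mat_index[of _ a _ b])
  also have "\<dots> = (\<Sum>x<a. \<Sum>m<b. \<Sum>y<a.
      complex_of_real (s m) * (G $$ (p, x * b + m) * X $$ (x, y) * cnj (G $$ (q, y * b + m))))"
    by (intro sum.cong refl) simp
  finally show ?thesis by (subst (asm) sum.swap)
qed

lemma dilated_map_carrier [simp, intro]: "dilated_map a b G D X \<in> carrier_mat a a"
  by (simp add: dilated_map_def)

text \<open>The Kraus representation: a diagonal catalyst is a mixture of its basis states
  \<open>m\<close> with weights \<open>s m\<close>, and tracing it out sums over the final basis
  state \<open>l\<close>.\<close>

lemma dilated_map_index:
  assumes "G \<in> carrier_mat (a * b) (a * b)" "X \<in> carrier_mat a a" "i < a" "j < a"
  shows "dilated_map a b G (real_diag b s) X $$ (i, j)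
    = (\<Sum>l<b. \<Sum>m<b. \<Sum>x<a. \<Sum>y<a. complex_of_real (s m) *
        (kraus_mat a b G l m $$ (i, x) * X $$ (x, y) * cnj (kraus_mat a b G l m $$ (j, y))))"
proof -
  have "dilated_map a b G (real_diag b s) X $$ (i, j)
    = (\<Sum>l<b. (G * tensor_mat X (real_diag b s) * mat_adjoint G) $$ (i * b + l, j * b + l))"
    unfolding dilated_map_def using assms by (intro trace_snd_index) auto
  thus ?thesis using assms
    by (simp add: dilation_index[OF assms(1,2)] product_index_less del: index_mult_mat)
qed

text \<open>A reference system turns each Kraus operator into its tensor product with the identity.
  The output is thus a nonnegative combination of conjugates of \<open>M\<close>, which gives
  complete positivity here and, by keeping a single summand, the lower bound on the top eigenvalue
  later.\<close>

lemma id_tensor_dilated_map_index: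
  assumes "G \<in> carrier_mat (a * b) (a * b)" "M \<in> carrier_mat (k * a) (k * a)" "P < k * a" "Q < k * a"
  shows "id_tensor_map k a (dilated_map a b G (real_diag b s)) M $$ (P, Q)
    = (\<Sum>z\<in>{..<b} \<times> {..<b}. complex_of_real (s (snd z)) *
        (tensor_mat (1\<^sub>m k) (kraus_mat a b G (fst z) (snd z)) * M
          * mat_adjoint (tensor_mat (1\<^sub>m k) (kraus_mat a b G (fst z) (snd z)))) $$ (P, Q))"
proof -
  from assms(3) obtain p i where P: "p < k" "i < a" "P = p * a + i" by (rule product_index_cases)
  from assms(4) obtain q j where Q: "q < k" "j < a" "Q = q * a + j" by (rule product_index_cases)
  have block: "mat_block a M p q $$ (x, y) = M $$ (p * a + x, q * a + y)" if "x < a" "y < a" for x y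
    using that by (simp add: mat_block_def)
  have "id_tensor_map k a (dilated_map a b G (real_diag b s)) M $$ (P, Q)
      = dilated_map a b G (real_diag b s) (mat_block a M p q) $$ (i, j)"
    using assms P Q unfolding id_tensor_map_def by simp
  also have "\<dots> = (\<Sum>l<b. \<Sum>m<b. \<Sum>x<a. \<Sum>y<a. complex_of_real (s m) *
        (kraus_mat a b G l m $$ (i, x) * mat_block a M p q $$ (x, y) * cnj (kraus_mat a b G l m $$ (j, y))))"
    using P Q by (intro dilated_map_index assms(1)) (auto simp: mat_block_def)
  also have "\<dots> = (\<Sum>l<b. \<Sum>m<b. complex_of_real (s m) * (tensor_mat (1\<^sub>m k) (kraus_mat a b G l m) * M
          * mat_adjoint (tensor_mat (1\<^sub>m k) (kraus_mat a b G l m))) $$ (P, Q))"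
    unfolding P(3) Q(3) using P Q
    by (intro sum.cong refl, subst local_conj_index[OF _ assms(2)]) (auto simp: block sum_distrib_left)
  finally show ?thesis by (simp add: sum.cartesian_product case_prod_unfold)
qed

lemma id_tensor_map_carrier [simp, intro]: "id_tensor_map k a \<Phi> M \<in> carrier_mat (k * a) (k * a)"
  by (simp add: id_tensor_map_def)

lemma id_tensor_map_cong:
  assumes "\<And>X. X \<in> carrier_mat a a \<Longrightarrow> \<Phi> X = \<Psi> X"
  shows "id_tensor_map k a \<Phi> M = id_tensor_map k a \<Psi> M"
proof -
  have "\<Phi> (mat_block a M p q) = \<Psi> (mat_block a M p q)" for p q
    by (rule assms) (auto simp: mat_block_def)
  thus ?thesis unfolding id_tensor_map_def by (simp only:)
qed

lemma dilated_map_add: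
  assumes "G \<in> carrier_mat (a * b) (a * b)" "X \<in> carrier_mat a a" "Y \<in> carrier_mat a a"
  shows "dilated_map a b G (real_diag b s) (X + Y) = dilated_map a b G (real_diag b s) X + dilated_map a b G (real_diag b s) Y"
proof (rule eq_matI)
  fix i j assume "i < dim_row (dilated_map a b G (real_diag b s) X + dilated_map a b G (real_diag b s) Y)"
    "j < dim_col (dilated_map a b G (real_diag b s) X + dilated_map a b G (real_diag b s) Y)"
  hence ij: "i < a" "j < a" by (auto simp: dilated_map_def)
  show "dilated_map a b G (real_diag b s) (X + Y) $$ (i, j)
    = (dilated_map a b G (real_diag b s) X + dilated_map a b G (real_diag b s) Y) $$ (i, j)"
    using assms ij carrier_matD[OF dilated_map_carrier[of a b G "real_diag b s" Y]]
    by (simp add: dilated_map_index[of G a b] sum.distrib algebra_simps)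
qed (auto simp: dilated_map_def)

lemma dilated_map_smult:
  assumes "G \<in> carrier_mat (a * b) (a * b)" "X \<in> carrier_mat a a"
  shows "dilated_map a b G (real_diag b s) (c \<cdot>\<^sub>m X) = c \<cdot>\<^sub>m dilated_map a b G (real_diag b s) X"
proof (rule eq_matI)
  fix i j assume "i < dim_row (c \<cdot>\<^sub>m dilated_map a b G (real_diag b s) X)"
    "j < dim_col (c \<cdot>\<^sub>m dilated_map a b G (real_diag b s) X)"
  hence ij: "i < a" "j < a" by (auto simp: dilated_map_def)
  show "dilated_map a b G (real_diag b s) (c \<cdot>\<^sub>m X) $$ (i, j)
    = (c \<cdot>\<^sub>m dilated_map a b G (real_diag b s) X) $$ (i, j)"
    using assms ij carrier_matD[OF dilated_map_carrier[of a b G "real_diag b s" X]]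
    by (simp add: dilated_map_index[of G a b] sum_distrib_left mult_ac)
qed (auto simp: dilated_map_def)

lemma quantum_map_dilated_map:
  assumes "unitary_mat (a * b) G" "\<And>m. m < b \<Longrightarrow> 0 \<le> s m" "(\<Sum>m<b. s m) = 1"
  shows "quantum_map a (dilated_map a b G (real_diag b s))"
  unfolding quantum_map_def
proof (intro conjI ballI allI impI)
  note G = unitary_matD[OF assms(1)]
  fix X :: "complex mat" assume X: "X \<in> carrier_mat a a"
  show "mat_trace (dilated_map a b G (real_diag b s) X) = mat_trace X"
    unfolding dilated_map_def using G X assms
    by (simp add: mat_trace_trace_snd mat_trace_unitary_conj mat_trace_tensor[of _ a _ b] mat_trace_real_diag)
next
  note G = unitary_matD[OF assms(1)]
  fix k :: nat and X assume X: "positive_mat (k * a) X"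
  note Xc = positive_matD[OF X]
  show "positive_mat (k * a) (id_tensor_map k a (dilated_map a b G (real_diag b s)) X)"
    by (rule positive_mat_sum[where S = "{..<b} \<times> {..<b}" and c = "\<lambda>z. s (snd z)",
          OF _ _ _ id_tensor_dilated_map_index[OF G(1) Xc(1)]])
      (auto intro!: positive_mat_conj[OF X] assms(2))
qed (use unitary_matD[OF assms(1)] in \<open>auto simp: dilated_map_add dilated_map_smult\<close>)

subsection \<open>Catalytic maps in the eigenbasis of the catalyst\<close>

lemma tensor_conj_snd:
  assumes "W \<in> carrier_mat b b" "D \<in> carrier_mat b b" "X \<in> carrier_mat a a"
  shows "tensor_mat X (W * D * mat_adjoint W)
    = tensor_mat (1\<^sub>m a) W * tensor_mat X D * mat_adjoint (tensor_mat (1\<^sub>m a) W)"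
  using assms by (simp add: tensor_mat_adjoint[of _ a _ b] tensor_mat_mult[of _ a _ b])

lemma conj_conj:
  fixes A B M :: "complex mat"
  assumes "A \<in> carrier_mat n n" "B \<in> carrier_mat n n" "M \<in> carrier_mat n n"
  shows "A * (B * M * mat_adjoint B) * mat_adjoint A = (A * B) * M * mat_adjoint (A * B)"
  using assms by (simp add: mat_adjoint_mult[of _ n n _ n] square_mult_assoc[of _ n])

text \<open>If \<open>G\<close> restores the diagonal catalyst, then \<open>G\<close> transported to
  the original basis by \<open>W\<close> restores \<open>\<sigma>\<close>. The inner factors of
  \<open>W\<close> cancel and the outer one is lost in the trace over the catalyst, so the induced
  map is the same; the catalyst returns exactly, with \<open>1\<^sub>m b\<close> in the role of
  \<open>V\<close>.\<close>

lemma catalytic_map_dilated_mapI: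
  assumes G: "unitary_mat (a * b) G" and s: "\<And>m. m < b \<Longrightarrow> 0 \<le> s m" "(\<Sum>m<b. s m) = 1"
    and W: "unitary_mat b W"
    and cat: "\<And>\<rho>. quantum_state a \<rho> \<Longrightarrow>
      trace_fst a b (G * tensor_mat \<rho> (real_diag b s) * mat_adjoint G) = real_diag b s"
  shows "catalytic_map a b (W * real_diag b s * mat_adjoint W) (dilated_map a b G (real_diag b s))"
  unfolding catalytic_map_def
proof (intro conjI exI allI impI)
  note Gc = unitary_matD[OF G] and Wc = unitary_matD[OF W]
  let ?W = "tensor_mat (1\<^sub>m a) W" and ?\<sigma> = "W * real_diag b s * mat_adjoint W"
  let ?U = "?W * (G * mat_adjoint ?W)"
  show "quantum_map a (dilated_map a b G (real_diag b s))"
    by (rule quantum_map_dilated_map[OF G s])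
  have W': "unitary_mat (a * b) ?W" by (rule unitary_tensor_one[OF W])
  note W'c = unitary_matD[OF W']
  show U: "unitary_mat (a * b) ?U"
    by (intro unitary_mat_mult W' G unitary_mat_adjoint)
  show "unitary_mat b (1\<^sub>m b)" by (simp add: unitary_mat_def)
  fix \<rho> assume \<rho>: "quantum_state a \<rho>"
  note \<rho>c = quantum_stateD(1)[OF \<rho>]
  let ?T = "G * tensor_mat \<rho> (real_diag b s) * mat_adjoint G"
  have T: "?T \<in> carrier_mat (a * b) (a * b)" "tensor_mat \<rho> (real_diag b s) \<in> carrier_mat (a * b) (a * b)"
    using Gc \<rho>c by auto
  have "?U * tensor_mat \<rho> ?\<sigma> * mat_adjoint ?U
      = (?U * ?W) * tensor_mat \<rho> (real_diag b s) * mat_adjoint (?U * ?W)"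
    unfolding tensor_conj_snd[OF Wc(1) real_diag_carrier \<rho>c]
    using Gc W'c T(2) by (intro conj_conj) auto
  also have "?U * ?W = ?W * G"
    using Gc W'c by (simp add: square_mult_assoc[of _ "a * b"])
  also have "(?W * G) * tensor_mat \<rho> (real_diag b s) * mat_adjoint (?W * G) = ?W * ?T * mat_adjoint ?W"
    using Gc W'c T(2) by (intro conj_conj[symmetric]) auto
  finally have eq: "?U * tensor_mat \<rho> ?\<sigma> * mat_adjoint ?U = ?W * ?T * mat_adjoint ?W" .
  show "trace_snd a b (?U * tensor_mat \<rho> ?\<sigma> * mat_adjoint ?U) = dilated_map a b G (real_diag b s) \<rho>"
    unfolding eq dilated_map_def by (rule trace_snd_local_conj[OF W T(1)])
  show "trace_fst a b (?U * tensor_mat \<rho> ?\<sigma> * mat_adjoint ?U) = 1\<^sub>m b * ?\<sigma> * mat_adjoint (1\<^sub>m b)"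
    unfolding eq trace_fst_local_conj[OF Wc(1) T(1)] cat[OF \<rho>] using Wc by simp
qed

text \<open>Rotations on the catalyst before and after \<open>U\<close> bring every catalytic map to
  a form where the catalyst is diagonal and returns unchanged. Since they act on the catalyst alone,
  the map on states stays the same, and by linearity it stays the same on all matrices.\<close>

lemma catalytic_map_dilated_mapE:
  assumes cat: "catalytic_map a b (W * real_diag b s * mat_adjoint W) \<Phi>" and W: "unitary_mat b W" and a: "0 < a"
  obtains G where "unitary_mat (a * b) G"
    "\<And>X. X \<in> carrier_mat a a \<Longrightarrow> \<Phi> X = dilated_map a b G (real_diag b s) X"
    "\<And>\<rho>. quantum_state a \<rho> \<Longrightarrow>
      trace_fst a b (G * tensor_mat \<rho> (real_diag b s) * mat_adjoint G) = real_diag b s"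
proof -
  note Wc = unitary_matD[OF W]
  let ?W = "tensor_mat (1\<^sub>m a) W" and ?\<sigma> = "W * real_diag b s * mat_adjoint W"
  from cat obtain U V where U: "unitary_mat (a * b) U" and V: "unitary_mat b V"
    and tr: "\<And>\<rho>. quantum_state a \<rho> \<Longrightarrow> trace_snd a b (U * tensor_mat \<rho> ?\<sigma> * mat_adjoint U) = \<Phi> \<rho>"
      "\<And>\<rho>. quantum_state a \<rho> \<Longrightarrow> trace_fst a b (U * tensor_mat \<rho> ?\<sigma> * mat_adjoint U) = V * ?\<sigma> * mat_adjoint V"
    and qm: "quantum_map a \<Phi>"
    unfolding catalytic_map_def by blast
  note Uc = unitary_matD[OF U] and Vc = unitary_matD[OF V]
  \<comment> \<open>The final rotation undoes both the unitary \<open>V\<close> allowed by the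
    definition and the basis change \<open>W\<close>.\<close>
  define Z where "Z = mat_adjoint (V * W)"
  have VW: "unitary_mat b (V * W)" by (rule unitary_mat_mult[OF V W])
  hence Z: "unitary_mat b Z" unfolding Z_def by (rule unitary_mat_adjoint)
  note Zc = unitary_matD[OF Z]
  let ?Z = "tensor_mat (1\<^sub>m a) Z"
  have W': "unitary_mat (a * b) ?W" and Z': "unitary_mat (a * b) ?Z"
    by (rule unitary_tensor_one[OF W], rule unitary_tensor_one[OF Z])
  note W'c = unitary_matD[OF W'] and Z'c = unitary_matD[OF Z']
  let ?G = "?Z * (U * ?W)"
  have G: "unitary_mat (a * b) ?G" by (intro unitary_mat_mult U W' Z')
  have T: "U * tensor_mat X ?\<sigma> * mat_adjoint U \<in> carrier_mat (a * b) (a * b)" if "X \<in> carrier_mat a a" for X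
    using that Uc Wc by auto
  have eq: "?G * tensor_mat X (real_diag b s) * mat_adjoint ?G
      = ?Z * (U * tensor_mat X ?\<sigma> * mat_adjoint U) * mat_adjoint ?Z" if X: "X \<in> carrier_mat a a" for X
  proof -
    have D: "tensor_mat X (real_diag b s) \<in> carrier_mat (a * b) (a * b)" using X by auto
    have "?G * tensor_mat X (real_diag b s) * mat_adjoint ?G
        = ?Z * ((U * ?W) * tensor_mat X (real_diag b s) * mat_adjoint (U * ?W)) * mat_adjoint ?Z"
      using Uc W'c Z'c D by (intro conj_conj[symmetric]) auto
    also have "(U * ?W) * tensor_mat X (real_diag b s) * mat_adjoint (U * ?W)
        = U * tensor_mat X ?\<sigma> * mat_adjoint U"
      unfolding tensor_conj_snd[OF Wc(1) real_diag_carrier X]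
      using Uc W'c D by (intro conj_conj[symmetric]) auto
    finally show ?thesis .
  qed
  have snd: "dilated_map a b ?G (real_diag b s) \<rho> = \<Phi> \<rho>" if \<rho>: "quantum_state a \<rho>" for \<rho>
    unfolding dilated_map_def eq[OF quantum_stateD(1)[OF \<rho>]]
      trace_snd_local_conj[OF Z T[OF quantum_stateD(1)[OF \<rho>]]] by (rule tr(1)[OF \<rho>])
  have "\<Phi> X = dilated_map a b ?G (real_diag b s) X" if "X \<in> carrier_mat a a" for X
    by (rule linear_maps_eqI[OF a _ _ _ _ _ that])
      (use qm snd unitary_matD(1)[OF G] in \<open>auto simp: quantum_map_def dilated_map_add dilated_map_smult\<close>)
  moreover have "trace_fst a b (?G * tensor_mat \<rho> (real_diag b s) * mat_adjoint ?G) = real_diag b s"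
    if \<rho>: "quantum_state a \<rho>" for \<rho>
  proof -
    note \<rho>c = quantum_stateD(1)[OF \<rho>]
    have "V * ?\<sigma> * mat_adjoint V = (V * W) * real_diag b s * mat_adjoint (V * W)"
      using Vc Wc by (intro conj_conj) auto
    hence "trace_fst a b (?G * tensor_mat \<rho> (real_diag b s) * mat_adjoint ?G)
        = Z * ((V * W) * real_diag b s * mat_adjoint (V * W)) * mat_adjoint Z"
      unfolding eq[OF \<rho>c] trace_fst_local_conj[OF Zc(1) T[OF \<rho>c]] tr(2)[OF \<rho>] by simp
    also have "\<dots> = real_diag b s"
      unfolding Z_def using unitary_conj_cancel(2)[OF VW real_diag_carrier[of b s]] by simp
    finally show ?thesis .
  qed
  ultimately show thesis by (rule that[OF G])
qed

text \<open>With \<open>E = real_diag n e\<close>, the squared distance from \<open>T\<close> to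
  \<open>E\<close> is the squared norm of \<open>T\<close>, minus twice the real inner product with
  \<open>E\<close>, plus the squared norm of \<open>E\<close>. The hypotheses make this zero. As
  \<open>E\<close> is diagonal, only the diagonal of \<open>T\<close> enters the cross term.\<close>

lemma eq_real_diag_of_frobenius:
  assumes "T \<in> carrier_mat n n"
    and "(\<Sum>x<n. \<Sum>y<n. (cmod (T $$ (x, y)))\<^sup>2) = (\<Sum>x<n. (e x)\<^sup>2)"
    and "(\<Sum>x<n. e x * Re (T $$ (x, x))) = (\<Sum>x<n. (e x)\<^sup>2)"
  shows "T = real_diag n e"
proof -
  have pt: "(cmod (T $$ (x, y) - real_diag n e $$ (x, y)))\<^sup>2
      = (cmod (T $$ (x, y)))\<^sup>2 - (if y = x then 2 * (e x * Re (T $$ (x, x))) - (e x)\<^sup>2 else 0)"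
    if "x < n" "y < n" for x y
  proof -
    have "(cmod (t - complex_of_real r))\<^sup>2 = (cmod t)\<^sup>2 - (2 * (r * Re t) - r\<^sup>2)" for t r
      unfolding cmod_power2 by (simp add: power2_eq_square algebra_simps)
    thus ?thesis using that by simp
  qed
  have "(\<Sum>x<n. \<Sum>y<n. (cmod (T $$ (x, y) - real_diag n e $$ (x, y)))\<^sup>2)
    = (\<Sum>x<n. \<Sum>y<n. (cmod (T $$ (x, y)))\<^sup>2 - (if y = x then 2 * (e x * Re (T $$ (x, x))) - (e x)\<^sup>2 else 0))"
    by (intro sum.cong refl pt) auto
  also have "\<dots> = (\<Sum>x<n. \<Sum>y<n. (cmod (T $$ (x, y)))\<^sup>2)
      - (2 * (\<Sum>x<n. e x * Re (T $$ (x, x))) - (\<Sum>x<n. (e x)\<^sup>2))"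
    by (simp add: sum_subtractf sum_distrib_left)
  also have "\<dots> = 0" by (simp add: assms(2,3))
  finally have 0: "(\<Sum>x<n. \<Sum>y<n. (cmod (T $$ (x, y) - real_diag n e $$ (x, y)))\<^sup>2) = 0" .
  have "T $$ (x, y) = real_diag n e $$ (x, y)" if xy: "x < n" "y < n" for x y
  proof -
    have "(\<Sum>y<n. (cmod (T $$ (x, y) - real_diag n e $$ (x, y)))\<^sup>2) = 0"
      using 0 xy(1) by (subst (asm) sum_nonneg_eq_0_iff) (auto intro: sum_nonneg)
    thus ?thesis using xy(2) by (subst (asm) sum_nonneg_eq_0_iff) auto
  qed
  thus ?thesis using assms(1) by (intro eq_matI) (auto simp: real_diag_def)
qed

lemma tensor_real_diag:
  "tensor_mat (real_diag a f) (real_diag b s) = real_diag (a * b) (\<lambda>x. f (x div b) * s (x mod b))"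
  by (rule eq_mat_productI[of _ a b])
    (auto simp: tensor_mat_index[of _ a _ b] product_index_less product_index_eq_iff)

text \<open>One input, the maximally mixed state, already forces this. It shows that
  \<open>G\<close> commutes with the diagonal matrix \<open>E\<close>, and comparing one entry of
  \<open>G * E\<close> and \<open>E * G\<close> gives a factor \<open>s m - s l\<close> that cannot
  vanish.\<close>

lemma catalytic_unitary_block_diagonal:
  assumes G: "unitary_mat (a * b) G"
    and cat: "\<And>\<rho>. quantum_state a \<rho> \<Longrightarrow>
      trace_fst a b (G * tensor_mat \<rho> (real_diag b s) * mat_adjoint G) = real_diag b s"
    and i: "i < a" and l: "l < b" and j: "j < a" and m: "m < b" and ne: "s l \<noteq> s m"
  shows "G $$ (i * b + l, j * b + m) = 0"
proof -
  note Gc = unitary_matD[OF G]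
  \<comment> \<open>The spectrum of the maximally mixed state tensored with the catalyst;
    \<open>x mod b\<close> is the catalyst index of position \<open>x\<close>.\<close>
  define e where "e x = 1 / real a * s (x mod b)" for x
  have a: "0 < a" using i by auto
  have "quantum_state a (1\<^sub>m a * real_diag a (\<lambda>_. 1 / real a) * mat_adjoint (1\<^sub>m a))"
    using a by (intro quantum_state_spectralI) (auto simp: unitary_mat_def)
  hence st: "quantum_state a (real_diag a (\<lambda>_. 1 / real a))"
    by (simp add: right_mult_one_mat[OF real_diag_carrier] left_mult_one_mat[OF real_diag_carrier])
  define E where "E = real_diag (a * b) e"
  have E: "E \<in> carrier_mat (a * b) (a * b)" by (simp add: E_def)
  have Eherm: "hermitian_mat (a * b) E" by (auto simp: E_def intro!: hermitian_matI)
  define T where "T = G * E * mat_adjoint G"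
  have T: "hermitian_mat (a * b) T" unfolding T_def by (rule hermitian_mat_conj[OF Eherm Gc(1)])
  note Tc = hermitian_matD[OF T]
  have fst: "trace_fst a b T = real_diag b s"
    using cat[OF st] unfolding tensor_real_diag T_def E_def e_def .
  have diag: "(\<Sum>i<a. T $$ (i * b + l, i * b + l)) = complex_of_real (s l)" if "l < b" for l
    using arg_cong[OF fst, of "\<lambda>M. M $$ (l, l)"] that by (simp add: trace_fst_index)
  have e2: "(\<Sum>x<a * b. (e x)\<^sup>2) = (\<Sum>l<b. (s l)\<^sup>2) / real a"
    using a by (simp add: sum_product_index e_def power2_eq_square flip: sum_divide_distrib)
  have "T = E" unfolding E_def
  proof (rule eq_real_diag_of_frobenius[OF Tc(1)])
    \<comment> \<open>Unitary invariance of the Frobenius norm, which for a Hermitian matrix is the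
      trace of its square (\<open>hs\<close> below).\<close>
    have "mat_trace (T * T) = mat_trace (E * E)"
    proof -
      have "T * T = G * (E * E) * mat_adjoint G"
        unfolding T_def using Gc E
        by (simp add: square_mult_assoc[of _ "a * b"] adjoint_mult_cancel(1)[OF G, of _ "a * b"])
      thus ?thesis using E by (simp add: mat_trace_unitary_conj[OF G])
    qed
    moreover have hs: "mat_trace (H * H) = complex_of_real (\<Sum>x<a * b. \<Sum>y<a * b. (cmod (H $$ (x, y)))\<^sup>2)"
      if "hermitian_mat (a * b) H" for H
    proof -
      note H = hermitian_matD[OF that]
      have "mat_trace (H * H) = (\<Sum>x<a * b. \<Sum>y<a * b. H $$ (x, y) * H $$ (y, x))"
        using H(1) by (subst mat_trace_sum[of _ "a * b"])
          (auto intro!: sum.cong index_mult_mat_sum[of _ "a * b" "a * b"] simp del: index_mult_mat)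
      also have "\<dots> = (\<Sum>x<a * b. \<Sum>y<a * b. H $$ (x, y) * cnj (H $$ (x, y)))"
        by (intro sum.cong refl arg_cong2[of _ _ _ _ "(*)"] H(2)) auto
      finally show ?thesis by (simp add: complex_norm_square del: of_real_power)
    qed
    ultimately have "(\<Sum>x<a * b. \<Sum>y<a * b. (cmod (T $$ (x, y)))\<^sup>2) = (\<Sum>x<a * b. \<Sum>y<a * b. (cmod (E $$ (x, y)))\<^sup>2)"
      using hs[OF T] hs[OF Eherm] by (metis of_real_eq_iff)
    also have "\<dots> = (\<Sum>x<a * b. \<Sum>y<a * b. if y = x then (e x)\<^sup>2 else 0)"
      by (intro sum.cong refl) (auto simp: E_def)
    finally show "(\<Sum>x<a * b. \<Sum>y<a * b. (cmod (T $$ (x, y)))\<^sup>2) = (\<Sum>x<a * b. (e x)\<^sup>2)" by simp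
    \<comment> \<open>Since \<open>e\<close> depends only on the catalyst index, summing over the
      system first leaves the diagonal of the catalyst marginal, which is \<open>s\<close>.\<close>
    have "(\<Sum>x<a * b. e x * Re (T $$ (x, x))) = (\<Sum>i<a. \<Sum>l<b. s l / real a * Re (T $$ (i * b + l, i * b + l)))"
      by (simp add: sum_product_index e_def)
    also have "\<dots> = (\<Sum>l<b. \<Sum>i<a. s l / real a * Re (T $$ (i * b + l, i * b + l)))" by (rule sum.swap)
    also have "\<dots> = (\<Sum>l<b. s l / real a * Re (\<Sum>i<a. T $$ (i * b + l, i * b + l)))"
      by (simp add: sum_distrib_left)
    also have "\<dots> = (\<Sum>l<b. s l / real a * s l)" by (intro sum.cong refl) (simp add: diag del: Re_sum)
    also have "\<dots> = (\<Sum>x<a * b. (e x)\<^sup>2)"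
      unfolding e2 by (simp add: power2_eq_square sum_divide_distrib)
    finally show "(\<Sum>x<a * b. e x * Re (T $$ (x, x))) = (\<Sum>x<a * b. (e x)\<^sup>2)" .
  qed
  hence "G * E * mat_adjoint G * G = E * G" by (simp add: T_def)
  hence GE: "G * E = E * G" using Gc E by (simp add: square_mult_assoc[of _ "a * b"])
  let ?p = "i * b + l" and ?q = "j * b + m"
  have pq: "?p < a * b" "?q < a * b" using i l j m by (auto intro: product_index_less)
  have "(G * E) $$ (?p, ?q) = (\<Sum>x<a * b. G $$ (?p, x) * E $$ (x, ?q))"
    using Gc E pq by (intro index_mult_mat_sum) auto
  also have "\<dots> = (\<Sum>x<a * b. if x = ?q then G $$ (?p, x) * complex_of_real (e x) else 0)"
    using pq by (intro sum.cong) (auto simp: E_def)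
  finally have 1: "(G * E) $$ (?p, ?q) = G $$ (?p, ?q) * complex_of_real (s m / real a)"
    using pq m by (simp add: e_def)
  have "(E * G) $$ (?p, ?q) = (\<Sum>x<a * b. E $$ (?p, x) * G $$ (x, ?q))"
    using Gc E pq by (intro index_mult_mat_sum) auto
  also have "\<dots> = (\<Sum>x<a * b. if x = ?p then complex_of_real (e x) * G $$ (x, ?q) else 0)"
    using pq by (intro sum.cong) (auto simp: E_def)
  finally have 2: "(E * G) $$ (?p, ?q) = complex_of_real (s l / real a) * G $$ (?p, ?q)"
    using pq l by (simp add: e_def)
  show ?thesis using 1 2 GE ne a by simp
qed

subsection \<open>The upper bound\<close>

text \<open>Removing from \<open>y\<close> its component along \<open>v\<close> leaves
  \<open>z\<close>. The complement of an eigenvector is invariant under \<open>\<rho>\<close>, so no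
  cross terms appear, and the form at \<open>z\<close> is nonnegative by positivity.\<close>

lemma eigenvector_form_le:
  fixes \<rho> :: "complex mat" and L :: real
  assumes "positive_mat n \<rho>" "v \<in> carrier_vec n" "y \<in> carrier_vec n"
    and eig: "\<rho> *\<^sub>v v = complex_of_real L \<cdot>\<^sub>v v" and norm: "v \<bullet>c v = 1"
  shows "L * (cmod (v \<bullet>c y))\<^sup>2 \<le> Re ((\<rho> *\<^sub>v y) \<bullet>c y)"
proof -
  note \<rho> = positive_matD[OF assms(1)]
  have \<rho>_adj: "mat_adjoint \<rho> = \<rho>" using \<rho>(2) by (simp add: hermitian_mat_def)
  define c where "c = v \<bullet>c y"
  have yv: "y \<bullet>c v = cnj c"
    unfolding c_def cscalar_prod_sum[OF assms(2,3)] cscalar_prod_sum[OF assms(3,2)] by (simp add: mult.commute)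
  \<comment> \<open>The coefficient is conjugated because \<open>\<bullet>c\<close> is
    conjugate-linear in its second argument: the component of \<open>y\<close> along
    \<open>v\<close> is \<open>y \<bullet>c v = cnj c\<close>.\<close>
  define z where "z = y + (- cnj c) \<cdot>\<^sub>v v"
  have z: "z \<in> carrier_vec n" using assms by (simp add: z_def)
  have \<rho>y: "\<rho> *\<^sub>v y \<in> carrier_vec n" using \<rho>(1) assms(3) by (rule mult_mat_vec_carrier)
  have \<rho>yv: "(\<rho> *\<^sub>v y) \<bullet>c v = complex_of_real L * cnj c"
    using adjoint_cscalar_prod[OF \<rho>(1) assms(3,2)] assms(2,3) yv
    by (simp add: \<rho>_adj eig conjugate_smult_vec)
  have \<rho>z: "\<rho> *\<^sub>v z = \<rho> *\<^sub>v y + (- cnj c * complex_of_real L) \<cdot>\<^sub>v v"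
    unfolding z_def using \<rho>(1) assms(2,3)
    by (simp add: mult_add_distrib_mat_vec[of _ n n] mult_mat_vec[of _ n n] eig smult_smult_assoc)
  have vz: "v \<bullet>c z = 0"
    unfolding z_def using assms(2,3) norm
    by (simp add: conjugate_add_vec[of _ n] conjugate_smult_vec scalar_prod_add_distrib[of _ n] flip: c_def)
  have "(\<rho> *\<^sub>v z) \<bullet>c z = (\<rho> *\<^sub>v y) \<bullet>c z"
    unfolding \<rho>z using assms(2) z \<rho>y vz by (simp add: add_scalar_prod_distrib[of _ n])
  also have "\<dots> = (\<rho> *\<^sub>v y) \<bullet>c y - complex_of_real L * (c * cnj c)"
    unfolding z_def using assms(2,3) \<rho>y \<rho>yv
    by (simp add: conjugate_add_vec[of _ n] conjugate_smult_vec scalar_prod_add_distrib[of _ n])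
  also have "c * cnj c = complex_of_real ((cmod c)\<^sup>2)" by (simp add: complex_norm_square del: of_real_power)
  finally have "Re ((\<rho> *\<^sub>v z) \<bullet>c z) = Re ((\<rho> *\<^sub>v y) \<bullet>c y) - L * (cmod c)\<^sup>2"
    by (simp del: of_real_power)
  with \<rho>(3)[OF z] show ?thesis by (simp add: c_def)
qed

lemma local_kraus_vec_index:
  assumes "v \<in> carrier_vec (k * a)" "p < k" "i < a"
  shows "(tensor_mat (1\<^sub>m k) (kraus_mat a b G l m) *\<^sub>v v) $ (p * a + i)
    = (\<Sum>x<a. G $$ (i * b + l, x * b + m) * v $ (p * a + x))"
proof -
  have "(tensor_mat (1\<^sub>m k) (kraus_mat a b G l m) *\<^sub>v v) $ (p * a + i)
      = (\<Sum>q<k. \<Sum>x<a. tensor_mat (1\<^sub>m k) (kraus_mat a b G l m) $$ (p * a + i, q * a + x) * v $ (q * a + x))"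
    using assms by (subst mult_mat_vec_sum[of _ "k * a" "k * a"]) (auto intro: product_index_less simp: sum_product_index)
  also have "\<dots> = (\<Sum>q<k. if q = p then \<Sum>x<a. G $$ (i * b + l, x * b + m) * v $ (p * a + x) else 0)"
    using assms by (intro sum.cong refl) (auto simp: tensor_mat_index[of _ k _ a])
  finally show ?thesis using assms by simp
qed

text \<open>For a unit vector \<open>v\<close>, the squared norms of the \<open>w l\<close> form the
  probability distribution of the catalyst basis state after evolving \<open>v\<close> tensor
  \<open>m\<close>. The total is preserved in each reference block, since \<open>G\<close> is an
  isometry.\<close>

lemma kraus_norm_sum:
  assumes G: "unitary_mat (a * b) G" and m: "m < b" and v: "v \<in> carrier_vec (k * a)"
  defines "w \<equiv> \<lambda>l. tensor_mat (1\<^sub>m k) (kraus_mat a b G l m) *\<^sub>v v"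
  shows "(\<Sum>l<b. \<Sum>x<k * a. (cmod (w l $ x))\<^sup>2) = (\<Sum>x<k * a. (cmod (v $ x))\<^sup>2)"
proof -
  note Gc = unitary_matD[OF G]
  have block: "(\<Sum>i<a. \<Sum>l<b. (cmod (w l $ (p * a + i)))\<^sup>2) = (\<Sum>x<a. (cmod (v $ (p * a + x)))\<^sup>2)"
    if p: "p < k" for p
  proof -
    \<comment> \<open>Block \<open>p\<close> of \<open>v\<close>, tensored with the catalyst basis
      state \<open>m\<close>.\<close>
    define u where "u = vec (a * b) (\<lambda>y. if y mod b = m then v $ (p * a + y div b) else 0)"
    have u: "u \<in> carrier_vec (a * b)" by (simp add: u_def)
    have ui: "u $ (x * b + y) = (if y = m then v $ (p * a + x) else 0)" if "x < a" "y < b" for x y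
      using that by (simp add: u_def product_index_less)
    have Gu: "G *\<^sub>v u \<in> carrier_vec (a * b)" using Gc u by (intro mult_mat_vec_carrier[of _ "a * b" "a * b"])
    have Gui: "(G *\<^sub>v u) $ (i * b + l) = w l $ (p * a + i)" if il: "i < a" "l < b" for i l
    proof -
      have "(G *\<^sub>v u) $ (i * b + l) = (\<Sum>x<a. \<Sum>y<b. G $$ (i * b + l, x * b + y) * u $ (x * b + y))"
        using Gc u il by (subst mult_mat_vec_sum[of _ "a * b" "a * b"]) (auto intro: product_index_less simp: sum_product_index)
      also have "\<dots> = (\<Sum>x<a. \<Sum>y<b. if y = m then G $$ (i * b + l, x * b + m) * v $ (p * a + x) else 0)"
        by (intro sum.cong refl) (simp add: ui)
      finally show ?thesis
        unfolding w_def local_kraus_vec_index[OF v p il(1)] using m by simp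
    qed
    have "(\<Sum>i<a. \<Sum>l<b. (cmod (w l $ (p * a + i)))\<^sup>2) = (\<Sum>i<a. \<Sum>l<b. (cmod ((G *\<^sub>v u) $ (i * b + l)))\<^sup>2)"
      by (intro sum.cong refl) (simp add: Gui del: index_mult_mat_vec)
    also have "\<dots> = (\<Sum>i<a. \<Sum>l<b. (cmod (u $ (i * b + l)))\<^sup>2)"
    proof -
      have "complex_of_real (\<Sum>x<a * b. (cmod ((G *\<^sub>v u) $ x))\<^sup>2) = complex_of_real (\<Sum>x<a * b. (cmod (u $ x))\<^sup>2)"
        using unitary_norm[OF G u] unfolding cscalar_prod_self[OF u] cscalar_prod_self[OF Gu] .
      hence "(\<Sum>x<a * b. (cmod ((G *\<^sub>v u) $ x))\<^sup>2) = (\<Sum>x<a * b. (cmod (u $ x))\<^sup>2)"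
        by (simp only: of_real_eq_iff)
      thus ?thesis unfolding sum_product_index .
    qed
    also have "\<dots> = (\<Sum>i<a. \<Sum>l<b. if l = m then (cmod (v $ (p * a + i)))\<^sup>2 else 0)"
      by (intro sum.cong refl) (simp add: ui)
    finally show ?thesis using m by simp
  qed
  have "(\<Sum>l<b. \<Sum>x<k * a. (cmod (w l $ x))\<^sup>2) = (\<Sum>x<k * a. \<Sum>l<b. (cmod (w l $ x))\<^sup>2)"
    by (rule sum.swap)
  also have "\<dots> = (\<Sum>x<k * a. (cmod (v $ x))\<^sup>2)"
    unfolding sum_product_index by (intro sum.cong refl block) auto
  finally show ?thesis .
qed

text \<open>The test vector is \<open>w l\<close>, the unnormalized output when the catalyst goes
  from \<open>m\<close> to \<open>l\<close>, for an \<open>l\<close> of large weight. Only the Kraus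
  term that produced it is kept, and in that term only the contribution of the top eigenvector of
  \<open>\<rho>\<close>.\<close>

lemma dilated_map_largest_eigenvalue_ge:
  assumes G: "unitary_mat (a * b) G"
    and s: "\<And>m. m < b \<Longrightarrow> 0 \<le> s m" "(\<Sum>m<b. s m) = 1"
    and block: "\<And>i l j. i < a \<Longrightarrow> l < b \<Longrightarrow> j < a \<Longrightarrow> s l \<noteq> s m \<Longrightarrow> G $$ (i * b + l, j * b + m) = 0"
    and m: "m < b"
    and \<rho>: "quantum_state (k * a) \<rho>"
  shows "s m / real (card {l. l < b \<and> s l = s m}) * largest_eigenvalue \<rho>
    \<le> largest_eigenvalue (id_tensor_map k a (dilated_map a b G (real_diag b s)) \<rho>)"
proof -
  note Gc = unitary_matD[OF G] and \<rho>c = quantum_stateD[OF \<rho>]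
  let ?n = "k * a" and ?S = "{l. l < b \<and> s l = s m}"
  define r where "r = real (card ?S)"
  define N where "N = id_tensor_map k a (dilated_map a b G (real_diag b s)) \<rho>"
  define L where "L = largest_eigenvalue \<rho>"
  define B where "B z = tensor_mat (1\<^sub>m k) (kraus_mat a b G (fst z) (snd z))" for z
  have B: "B z \<in> carrier_mat ?n ?n" for z unfolding B_def by auto
  have "positive_mat ?n N"
    unfolding N_def using quantum_map_dilated_map[of a b G s, OF G s] \<rho>c(3) by (auto simp: quantum_map_def)
  hence N: "N \<in> carrier_mat ?n ?n" "hermitian_mat ?n N" by (rule positive_matD)+
  have L0: "0 < L" unfolding L_def by (rule quantum_state_largest_eigenvalue_pos[OF \<rho>])
  have "eigenvalue \<rho> (complex_of_real L)"
    unfolding L_def by (rule largest_eigenvalue_in_spectrum[OF \<rho>c(2,5)])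
  then obtain f where f: "(\<Sum>i<?n. (cmod (f i))\<^sup>2) = 1"
      "\<And>i. i < ?n \<Longrightarrow> (\<Sum>j<?n. \<rho> $$ (i, j) * f j) = complex_of_real L * f i"
    by (rule eigenvector_normalized[OF \<rho>c(1,5)]) blast
  define v where "v = vec ?n f"
  have v: "v \<in> carrier_vec ?n" by (simp add: v_def)
  have vnorm: "v \<bullet>c v = 1" unfolding cscalar_prod_self[OF v] using f(1) by (simp add: v_def)
  have eig: "\<rho> *\<^sub>v v = complex_of_real L \<cdot>\<^sub>v v"
  proof (rule eq_vecI)
    fix i assume "i < dim_vec (complex_of_real L \<cdot>\<^sub>v v)"
    hence i: "i < ?n" by (simp add: v_def)
    have "(\<rho> *\<^sub>v v) $ i = (\<Sum>j<?n. \<rho> $$ (i, j) * v $ j)"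
      by (rule mult_mat_vec_sum[OF \<rho>c(1) v i])
    also have "\<dots> = (complex_of_real L \<cdot>\<^sub>v v) $ i" using f(2)[OF i] i by (simp add: v_def)
    finally show "(\<rho> *\<^sub>v v) $ i = (complex_of_real L \<cdot>\<^sub>v v) $ i" .
  qed (use \<rho>c(1) in \<open>auto simp: v_def\<close>)
  define w where "w l = B (l, m) *\<^sub>v v" for l
  define q where "q l = (\<Sum>x<?n. (cmod (w l $ x))\<^sup>2)" for l
  have w: "w l \<in> carrier_vec ?n" for l unfolding w_def by (rule mult_mat_vec_carrier[OF B v])
  have q0: "0 \<le> q l" for l unfolding q_def by (intro sum_nonneg) auto
  have wq: "w l \<bullet>c w l = complex_of_real (q l)" for l unfolding q_def by (rule cscalar_prod_self[OF w])
  have "(\<Sum>l<b. q l) = (\<Sum>x<?n. (cmod (v $ x))\<^sup>2)"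
    unfolding q_def w_def B_def fst_conv snd_conv by (rule kraus_norm_sum[OF G m v])
  hence total: "(\<Sum>l<b. q l) = 1" using f(1) by (simp add: v_def)
  have "q l = 0" if l: "l < b" "s l \<noteq> s m" for l
  proof -
    have "w l $ x = 0" if "x < ?n" for x
    proof -
      from that obtain p i where "p < k" "i < a" "x = p * a + i" by (rule product_index_cases)
      thus ?thesis
        unfolding w_def B_def using l by (simp add: local_kraus_vec_index[OF v] block del: index_mult_mat_vec)
    qed
    thus ?thesis unfolding q_def by simp
  qed
  hence "(\<Sum>l\<in>?S. q l) = (\<Sum>l<b. q l)" by (intro sum.mono_neutral_left) auto
  hence S1: "(\<Sum>l\<in>?S. q l) = 1" using total by simp
  have "?S \<noteq> {}" "finite ?S" using m by auto
  hence r: "0 < r" unfolding r_def by (simp add: card_gt_0_iff)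
  \<comment> \<open>Pigeonhole: the weights sum to 1 over a level of \<open>r\<close>
    positions.\<close>
  obtain l where l: "l \<in> ?S" "1 / r \<le> q l"
  proof (rule ccontr)
    assume "\<not> thesis"
    hence "\<And>l. l \<in> ?S \<Longrightarrow> q l < 1 / r" using that by force
    hence "(\<Sum>l\<in>?S. q l) < (\<Sum>l\<in>?S. 1 / r)" using \<open>?S \<noteq> {}\<close> by (intro sum_strict_mono) auto
    also have "\<dots> = 1" using r by (simp only: sum_constant flip: r_def) simp
    finally show False using S1 by simp
  qed
  have q: "0 < q l" using l(2) r by (smt (verit) divide_pos_pos)
  define y where "y z = mat_adjoint (B z) *\<^sub>v w l" for z
  have y: "y z \<in> carrier_vec ?n" for z
    unfolding y_def by (rule mult_mat_vec_carrier[OF mat_adjoint_carrier[OF B] w])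
  have "(N *\<^sub>v w l) \<bullet>c w l = (\<Sum>z\<in>{..<b} \<times> {..<b}. complex_of_real (s (snd z)) *
      (((B z * \<rho> * mat_adjoint (B z)) *\<^sub>v w l) \<bullet>c w l))"
  proof (rule form_sum[OF N(1) _ w])
    fix i j assume "i < ?n" "j < ?n"
    thus "N $$ (i, j) = (\<Sum>z\<in>{..<b} \<times> {..<b}. complex_of_real (s (snd z)) * (B z * \<rho> * mat_adjoint (B z)) $$ (i, j))"
      unfolding N_def B_def by (rule id_tensor_dilated_map_index[OF Gc(1) \<rho>c(1)])
  qed (use B \<rho>c(1) in auto)
  also have "\<dots> = (\<Sum>z\<in>{..<b} \<times> {..<b}. complex_of_real (s (snd z)) * ((\<rho> *\<^sub>v y z) \<bullet>c y z))"
    unfolding y_def by (intro sum.cong refl) (simp add: conj_form[OF B \<rho>c(1) w])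
  finally have "Re ((N *\<^sub>v w l) \<bullet>c w l) = (\<Sum>z\<in>{..<b} \<times> {..<b}. s (snd z) * Re ((\<rho> *\<^sub>v y z) \<bullet>c y z))"
    by simp
  \<comment> \<open>All Kraus terms are nonnegative, so the others may be dropped.\<close>
  also have "\<dots> \<ge> s (snd (l, m)) * Re ((\<rho> *\<^sub>v y (l, m)) \<bullet>c y (l, m))"
    using l m s(1) positive_matD(3)[OF \<rho>c(3) y]
    by (intro member_le_sum[of "(l, m)" _ "\<lambda>z. s (snd z) * Re ((\<rho> *\<^sub>v y z) \<bullet>c y z)"]) auto
  finally have 1: "s m * Re ((\<rho> *\<^sub>v y (l, m)) \<bullet>c y (l, m)) \<le> Re ((N *\<^sub>v w l) \<bullet>c w l)" by simp
  \<comment> \<open>Moving the adjoint across turns \<open>v\<close> into \<open>w l\<close>, so the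
    overlap with the top eigenvector is the weight \<open>q l\<close> itself.\<close>
  have "v \<bullet>c y (l, m) = w l \<bullet>c w l"
    unfolding y_def using adjoint_cscalar_prod[OF B v w, of "(l, m)" l] by (simp add: w_def)
  hence "cmod (v \<bullet>c y (l, m)) = q l" using q0[of l] by (simp add: wq)
  hence "L * (q l)\<^sup>2 \<le> Re ((\<rho> *\<^sub>v y (l, m)) \<bullet>c y (l, m))"
    using eigenvector_form_le[OF \<rho>c(3) v y[of "(l, m)"] eig vnorm] by simp
  hence "s m * (L * (q l)\<^sup>2) \<le> s m * Re ((\<rho> *\<^sub>v y (l, m)) \<bullet>c y (l, m))"
    by (rule mult_left_mono[OF _ s(1)[OF m]])
  also note 1
  also have "Re ((N *\<^sub>v w l) \<bullet>c w l) \<le> largest_eigenvalue N * Re (w l \<bullet>c w l)"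
    by (rule rayleigh_le_largest_eigenvalue[OF N(2) w])
  \<comment> \<open>The squared overlap stands against the squared norm \<open>q l\<close> of the
    test vector, so one factor \<open>q l\<close> cancels and one survives.\<close>
  finally have "(s m * L * q l) * q l \<le> largest_eigenvalue N * q l"
    by (simp add: wq power2_eq_square mult_ac)
  hence "s m * L * q l \<le> largest_eigenvalue N" using q by simp
  moreover have "s m * L * (1 / r) \<le> s m * L * q l"
    using l(2) s(1)[OF m] L0 by (intro mult_left_mono) auto
  ultimately show ?thesis unfolding N_def L_def r_def by (simp add: mult_ac)
qed

lemma quantum_state_id_tensor_map:
  assumes "quantum_map a \<Phi>" "quantum_state (k * a) \<rho>"
  shows "quantum_state (k * a) (id_tensor_map k a \<Phi> \<rho>)"
proof -
  note \<rho> = quantum_stateD[OF assms(2)]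
  have blk: "mat_block a \<rho> p p \<in> carrier_mat a a" for p by (simp add: mat_block_def)
  have "mat_trace (id_tensor_map k a \<Phi> \<rho>) = (\<Sum>p<k. \<Sum>i<a. \<Phi> (mat_block a \<rho> p p) $$ (i, i))"
    by (simp add: mat_trace_sum[of _ "k * a"] sum_product_index id_tensor_map_def product_index_less)
  also have "\<dots> = (\<Sum>p<k. mat_trace (\<Phi> (mat_block a \<rho> p p)))"
    using assms(1) blk by (intro sum.cong refl mat_trace_sum[symmetric]) (auto simp: quantum_map_def)
  also have "\<dots> = (\<Sum>p<k. mat_trace (mat_block a \<rho> p p))"
    using assms(1) blk by (intro sum.cong refl) (auto simp: quantum_map_def)
  also have "\<dots> = (\<Sum>p<k. \<Sum>i<a. \<rho> $$ (p * a + i, p * a + i))"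
    by (simp add: mat_trace_sum[OF blk]) (simp add: mat_block_def)
  also have "\<dots> = mat_trace \<rho>" by (simp add: mat_trace_sum[OF \<rho>(1)] sum_product_index)
  finally show ?thesis
    using assms(1) \<rho>(3,4) unfolding quantum_state_def quantum_map_def by simp
qed

text \<open>The bound is stated for each basis position \<open>m\<close> instead of for a maximum; a
  zero eigenvalue is then a harmless trivial case.\<close>

theorem catalytic_map_largest_eigenvalue_ge:
  assumes W: "unitary_mat b W" and s: "\<And>m. m < b \<Longrightarrow> 0 \<le> s m" "(\<Sum>m<b. s m) = 1"
    and cat: "catalytic_map a b (W * real_diag b s * mat_adjoint W) \<Phi>"
    and \<rho>: "quantum_state (k * a) \<rho>" and m: "m < b"
  shows "s m / real (card {l. l < b \<and> s l = s m}) * largest_eigenvalue \<rho>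
    \<le> largest_eigenvalue (id_tensor_map k a \<Phi> \<rho>)"
proof -
  have "0 < a" using quantum_stateD(5)[OF \<rho>] by simp
  then obtain G where G: "unitary_mat (a * b) G"
    "\<And>X. X \<in> carrier_mat a a \<Longrightarrow> \<Phi> X = dilated_map a b G (real_diag b s) X"
    "\<And>\<rho>. quantum_state a \<rho> \<Longrightarrow>
      trace_fst a b (G * tensor_mat \<rho> (real_diag b s) * mat_adjoint G) = real_diag b s"
    by (rule catalytic_map_dilated_mapE[OF cat W]) blast
  have eq: "id_tensor_map k a \<Phi> \<rho> = id_tensor_map k a (dilated_map a b G (real_diag b s)) \<rho>"
    by (rule id_tensor_map_cong[OF G(2)])
  show ?thesis
    unfolding eq
    by (rule dilated_map_largest_eigenvalue_ge[OF G(1) s _ m \<rho>])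
      (use m in \<open>auto intro: catalytic_unitary_block_diagonal[OF G(1,3)]\<close>)
qed

subsection \<open>Cyclic shifts inside the eigenspaces\<close>

lemma card_mod_eq:
  fixes q r k :: nat
  assumes "q < r"
  shows "card {y. y < k * r \<and> y mod r = q} = k"
proof -
  have "{y. y < k * r \<and> y mod r = q} = (\<lambda>t. t * r + q) ` {..<k}"
  proof
    show "{y. y < k * r \<and> y mod r = q} \<subseteq> (\<lambda>t. t * r + q) ` {..<k}"
    proof
      fix y assume "y \<in> {y. y < k * r \<and> y mod r = q}"
      hence y: "y < k * r" "y mod r = q" by auto
      from y(1) obtain t p where "t < k" "p < r" "y = t * r + p" by (rule product_index_cases)
      with y(2) show "y \<in> (\<lambda>t. t * r + q) ` {..<k}" by auto
    qed
    show "(\<lambda>t. t * r + q) ` {..<k} \<subseteq> {y. y < k * r \<and> y mod r = q}"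
      using assms by (auto intro: product_index_less)
  qed
  moreover have "inj_on (\<lambda>t. t * r + q) {..<k}" using assms by (auto intro: inj_onI)
  ultimately show ?thesis by (simp add: card_image)
qed

lemma add_mod_cancel_left:
  fixes p x y r :: nat
  shows "(p + x) mod r = (p + y) mod r \<longleftrightarrow> x mod r = y mod r"
proof -
  have "(int p + int x) mod int r = (int p + int y) mod int r \<longleftrightarrow> int x mod int r = int y mod int r"
    by (simp add: mod_eq_dvd_iff)
  thus ?thesis by (simp flip: of_nat_add of_nat_mod)
qed

text \<open>\<open>\<pi> y\<close> rotates each level set of \<open>s\<close> by \<open>y\<close>
  places. When \<open>N\<close> is a multiple of every level size, a uniform \<open>y\<close>
  reaches all points of a level equally often. The last clause expresses this as a coincidence
  count, because that is the number of nonzero entries in a row of the output state constructed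
  later.\<close>

lemma level_shifts_exist:
  fixes s :: "nat \<Rightarrow> real" and b :: nat
  obtains N :: nat and \<pi> :: "nat \<Rightarrow> nat \<Rightarrow> nat" where "0 < N"
    "\<And>y m. m < b \<Longrightarrow> \<pi> y m < b" "\<And>y m. m < b \<Longrightarrow> s (\<pi> y m) = s m"
    "\<And>y. inj_on (\<pi> y) {..<b}"
    "\<And>x m. m < b \<Longrightarrow> card {y. y < N \<and> \<pi> y m = \<pi> x m} * card {l. l < b \<and> s l = s m} = N"
proof -
  define S where "S c = {l. l < b \<and> s l = c}" for c
  have finS: "finite (S c)" for c unfolding S_def by auto
  have "\<exists>h. \<forall>c. bij_betw (h c) {0..<card (S c)} (S c)"
    by (intro choice allI ex_bij_betw_nat_finite finS)
  then obtain h where h: "\<And>c. bij_betw (h c) {0..<card (S c)} (S c)" by blast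
  define r where "r m = card (S (s m))" for m
  define pos where "pos m = inv_into {0..<r m} (h (s m)) m" for m
  \<comment> \<open>\<open>h\<close> numbers the points of each level and \<open>pos m\<close> is
    the number of \<open>m\<close> in its own level.\<close>
  define \<pi> where "\<pi> y m = h (s m) ((pos m + y) mod r m)" for y m
  have mS: "m \<in> S (s m)" if "m < b" for m using that by (simp add: S_def)
  have r: "0 < r m" if "m < b" for m
    unfolding r_def using mS[OF that] finS card_gt_0_iff by blast
  have hr: "bij_betw (h (s m)) {0..<r m} (S (s m))" for m unfolding r_def by (rule h)
  have pos: "pos m < r m" "h (s m) (pos m) = m" if "m < b" for m
    using bij_betw_inv_into_right[OF hr mS[OF that]] bij_betwE[OF bij_betw_inv_into[OF hr]] mS[OF that]
    unfolding pos_def by auto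
  have \<pi>S: "\<pi> y m \<in> S (s m)" if "m < b" for y m
    unfolding \<pi>_def using bij_betwE[OF hr] r[OF that] by auto
  have \<pi>_eq: "\<pi> y m = \<pi> y' m' \<longleftrightarrow> (pos m + y) mod r m = (pos m' + y') mod r m"
    if "m < b" "s m' = s m" for y m y' m'
  proof -
    have "r m' = r m" using that by (simp add: r_def)
    thus ?thesis
      unfolding \<pi>_def using that r[OF that(1)] bij_betw_imp_inj_on[OF hr[of m]]
      by (auto simp: inj_on_eq_iff)
  qed
  show thesis
  proof (rule that[of "fact b" \<pi>])
    show "0 < (fact b :: nat)" by simp
    show "\<pi> y m < b" "s (\<pi> y m) = s m" if "m < b" for y m
      using \<pi>S[OF that, of y] by (auto simp: S_def)
    show "inj_on (\<pi> y) {..<b}" for y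
    proof (rule inj_onI)
      fix m m' assume *: "m \<in> {..<b}" "m' \<in> {..<b}" "\<pi> y m = \<pi> y m'"
      hence "s m' = s m" using \<pi>S[of m y] \<pi>S[of m' y] by (auto simp: S_def)
      hence "(y + pos m) mod r m = (y + pos m') mod r m" using \<pi>_eq[of m m' y y] * by (simp add: add.commute)
      hence "pos m mod r m = pos m' mod r m" by (simp only: add_mod_cancel_left)
      moreover have "r m' = r m" using \<open>s m' = s m\<close> by (simp add: r_def)
      ultimately have "pos m = pos m'" using pos(1)[of m] pos(1)[of m'] * by auto
      hence "h (s m) (pos m) = h (s m') (pos m')" using \<open>s m' = s m\<close> by simp
      thus "m = m'" using pos(2) * by simp
    qed
    show "card {y. y < fact b \<and> \<pi> y m = \<pi> x m} * card {l. l < b \<and> s l = s m} = fact b" if m: "m < b" for x m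
    proof -
      \<comment> \<open>Every level size lies between 1 and \<open>b\<close>, hence divides
        \<open>fact b\<close>; this is the reason for that choice of \<open>N\<close>.\<close>
      have "r m \<le> card {..<b}" unfolding r_def by (rule card_mono) (auto simp: S_def)
      hence "r m dvd fact b" using r[OF m] by (intro dvd_fact) auto
      then obtain k where k: "fact b = k * r m" by (metis dvd_def mult.commute)
      have "{y. y < fact b \<and> \<pi> y m = \<pi> x m} = {y. y < k * r m \<and> y mod r m = x mod r m}"
        unfolding k by (auto simp: \<pi>_eq[OF m refl] add_mod_cancel_left)
      hence "card {y. y < fact b \<and> \<pi> y m = \<pi> x m} = k" using r[OF m] by (simp add: card_mod_eq)
      thus ?thesis unfolding k r_def S_def by simp
    qed
  qed
qed

subsection \<open>Attaining the bound\<close>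

lemma unitary_permutation_mat:
  assumes "inj_on f {..<n}" "f ` {..<n} \<subseteq> {..<n}"
  shows "unitary_mat n (mat n n (\<lambda>(i, j). if i = f j then 1 else 0))" (is "unitary_mat n ?P")
proof -
  have P: "?P \<in> carrier_mat n n" by simp
  have "mat_adjoint ?P * ?P = 1\<^sub>m n"
  proof (rule eq_matI)
    fix i j assume "i < dim_row (1\<^sub>m n :: complex mat)" "j < dim_col (1\<^sub>m n :: complex mat)"
    hence ij: "i < n" "j < n" by auto
    have "(mat_adjoint ?P * ?P) $$ (i, j) = (\<Sum>x<n. mat_adjoint ?P $$ (i, x) * ?P $$ (x, j))"
      using ij by (intro index_mult_mat_sum) auto
    also have "\<dots> = (\<Sum>x<n. if x = f i then (if f i = f j then 1 else 0) else 0)"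
      using ij by (intro sum.cong) auto
    also have "\<dots> = (if f i = f j then 1 else 0)" using assms(2) ij by auto
    also have "\<dots> = 1\<^sub>m n $$ (i, j)" using ij assms(1) by (auto simp: inj_on_eq_iff)
    finally show "(mat_adjoint ?P * ?P) $$ (i, j) = 1\<^sub>m n $$ (i, j)" .
  qed auto
  moreover from this have "?P * mat_adjoint ?P = 1\<^sub>m n"
    using mat_mult_left_right_inverse mat_adjoint_carrier[OF P] P by blast
  ultimately show ?thesis using P unfolding unitary_mat_def by auto
qed

text \<open>Read the eigenvalue equation at a coordinate of the eigenvector of maximal modulus. The
  bound is sharp enough for the output state below, where all rows of a block have the same absolute
  sum.\<close>

lemma eigenvalue_le_row_sum:
  fixes A :: "complex mat"
  assumes A: "A \<in> carrier_mat n n" and n: "0 < n" and e: "eigenvalue A e"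
  obtains i where "i < n" "cmod e \<le> (\<Sum>j<n. cmod (A $$ (i, j)))"
proof -
  obtain f where f: "(\<Sum>i<n. (cmod (f i))\<^sup>2) = 1" "\<And>i. i < n \<Longrightarrow> (\<Sum>j<n. A $$ (i, j) * f j) = e * f i"
    by (rule eigenvector_normalized[OF A n e]) blast
  have fin: "finite ((\<lambda>j. cmod (f j)) ` {..<n})" "(\<lambda>j. cmod (f j)) ` {..<n} \<noteq> {}" using n by auto
  from Max_in[OF fin] obtain i where i: "i < n" "cmod (f i) = Max ((\<lambda>j. cmod (f j)) ` {..<n})" by auto
  have max: "cmod (f j) \<le> cmod (f i)" if "j < n" for j
    unfolding i(2) using that fin by (intro Max_ge) auto
  have pos: "0 < cmod (f i)"
  proof (rule ccontr)
    assume "\<not> 0 < cmod (f i)"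
    hence "cmod (f j) = 0" if "j < n" for j using max[OF that] norm_ge_zero[of "f j"] by linarith
    hence "(\<Sum>i<n. (cmod (f i))\<^sup>2) = 0" by simp
    with f(1) show False by simp
  qed
  have "cmod e * cmod (f i) = cmod (\<Sum>j<n. A $$ (i, j) * f j)" by (simp add: f(2)[OF i(1)] norm_mult)
  also have "\<dots> \<le> (\<Sum>j<n. cmod (A $$ (i, j) * f j))" by (rule norm_sum)
  also have "\<dots> \<le> (\<Sum>j<n. cmod (A $$ (i, j)) * cmod (f i))"
    using max by (intro sum_mono) (auto simp: norm_mult intro!: mult_left_mono)
  also have "\<dots> = (\<Sum>j<n. cmod (A $$ (i, j))) * cmod (f i)" by (simp add: sum_distrib_right)
  finally have "cmod e \<le> (\<Sum>j<n. cmod (A $$ (i, j)))" using pos by simp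
  with i(1) show thesis by (rule that)
qed

text \<open>On a composite system \<open>A\<^sub>1 A\<^sub>2\<close> with \<open>A\<^sub>2\<close> of dimension \<open>N\<close>, this is \<open>|0><0|\<close> on \<open>A\<^sub>1\<close> tensor the
  pure uniform superposition on \<open>A\<^sub>2\<close>.\<close>

definition uniform_state :: "nat \<Rightarrow> nat \<Rightarrow> complex mat" where
  "uniform_state a N = mat a a (\<lambda>(x, y). if x < N \<and> y < N then 1 / of_nat N else 0)"

text \<open>The matrix is a rank-one projector, so its form is a squared overlap. Positivity and the
  eigenvalue 1 both follow from this formula.\<close>

lemma uniform_state_form:
  assumes "v \<in> carrier_vec a" "N \<le> a"
  shows "Re ((uniform_state a N *\<^sub>v v) \<bullet>c v) = (cmod (\<Sum>x<N. v $ x))\<^sup>2 / real N"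
proof -
  define S where "S = (\<Sum>x<N. v $ x)"
  have restrict: "(\<Sum>x<a. if x < N then g x else 0) = (\<Sum>x<N. g x)" for g :: "nat \<Rightarrow> complex"
    using assms(2) by (intro sum.mono_neutral_cong_right) auto
  have c: "uniform_state a N \<in> carrier_mat a a" by (simp add: uniform_state_def)
  have "(uniform_state a N *\<^sub>v v) $ x = (if x < N then S / of_nat N else 0)" if x: "x < a" for x
  proof -
    have "(uniform_state a N *\<^sub>v v) $ x = (\<Sum>y<a. uniform_state a N $$ (x, y) * v $ y)"
      by (rule mult_mat_vec_sum[OF c assms(1) x])
    also have "\<dots> = (\<Sum>y<a. if y < N then if x < N then v $ y / of_nat N else 0 else 0)"
      using x by (intro sum.cong) (auto simp: uniform_state_def)
    finally show ?thesis unfolding restrict by (auto simp: S_def sum_divide_distrib)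
  qed
  hence "(uniform_state a N *\<^sub>v v) \<bullet>c v = (\<Sum>x<a. if x < N then S / of_nat N * cnj (v $ x) else 0)"
    using c assms(1) by (subst cscalar_prod_sum[of _ a]) (auto intro!: sum.cong mult_mat_vec_carrier[of _ a a])
  also have "\<dots> = S * cnj S / of_nat N"
    unfolding restrict by (simp add: S_def flip: sum_distrib_left sum_divide_distrib)
  also have "S * cnj S = complex_of_real ((cmod S)\<^sup>2)"
    by (simp only: complex_norm_square)
  also have "complex_of_real ((cmod S)\<^sup>2) / of_nat N = complex_of_real ((cmod S)\<^sup>2 / real N)"
    by simp
  finally show ?thesis by (simp only: Re_complex_of_real S_def)
qed

lemma quantum_state_uniform_state:
  assumes "0 < N" "N \<le> a"
  shows "quantum_state a (uniform_state a N)"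
proof -
  have "hermitian_mat a (uniform_state a N)"
    by (rule hermitian_matI) (auto simp: uniform_state_def)
  moreover have "mat_trace (uniform_state a N) = 1"
  proof -
    have "mat_trace (uniform_state a N) = (\<Sum>x<a. if x < N then 1 / of_nat N else 0)"
      by (subst mat_trace_sum[of _ a]) (auto simp: uniform_state_def intro!: sum.cong)
    also have "\<dots> = (\<Sum>x<N. 1 / of_nat N)"
      using assms(2) by (intro sum.mono_neutral_cong_right) auto
    finally show ?thesis using assms(1) by simp
  qed
  ultimately show ?thesis
    unfolding quantum_state_def positive_mat_def by (simp add: uniform_state_form[OF _ assms(2)])
qed

text \<open>Says that the input has min-entropy at most 0. This inequality suffices, since the
  general upper bound on extraction turns the final estimate into an equality.\<close>

lemma largest_eigenvalue_uniform_state: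
  assumes "0 < N" "N \<le> a"
  shows "1 \<le> largest_eigenvalue (uniform_state a N)"
proof -
  define v where "v = vec a (\<lambda>x. if x < N then 1 else 0 :: complex)"
  have v: "v \<in> carrier_vec a" by (simp add: v_def)
  have "v \<bullet>c v = complex_of_real (\<Sum>x<a. if x < N then 1 else 0)"
    unfolding cscalar_prod_self[OF v] by (intro arg_cong[of _ _ complex_of_real] sum.cong) (auto simp: v_def)
  also have "(\<Sum>x<a. if x < N then 1 else 0) = (\<Sum>x<N. 1 :: real)"
    using assms(2) by (intro sum.mono_neutral_cong_right) auto
  finally have vv: "Re (v \<bullet>c v) = real N" by simp
  have "(\<Sum>x<N. v $ x) = of_nat N" using assms(2) by (simp add: v_def)
  hence "Re ((uniform_state a N *\<^sub>v v) \<bullet>c v) = real N"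
    using assms(1) by (simp add: uniform_state_form[OF v assms(2)] power2_eq_square)
  moreover have "Re ((uniform_state a N *\<^sub>v v) \<bullet>c v) \<le> largest_eigenvalue (uniform_state a N) * Re (v \<bullet>c v)"
    by (rule rayleigh_le_largest_eigenvalue[OF quantum_stateD(2)[OF quantum_state_uniform_state[OF assms]] v])
  ultimately show ?thesis using assms(1) by (simp add: vv)
qed

text \<open>The unitary on \<open>A = A\<^sub>1 A\<^sub>2\<close> (dimensions \<open>b\<close> and \<open>N\<close>) and the catalyst is the permutation
  \<open>(u, x, m) \<mapsto> (u + m mod b, x, \<pi>\<^sub>x m)\<close>: the value of the catalyst is written into \<open>A\<^sub>1\<close>, and the shift of
  the catalyst controlled by \<open>A\<^sub>2\<close> dephases the uniform superposition on \<open>A\<^sub>2\<close>.\<close>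

theorem catalytic_map_attaining_bound:
  assumes W: "unitary_mat b W" and s: "\<And>m. m < b \<Longrightarrow> 0 \<le> s m" "(\<Sum>m<b. s m) = 1"
  obtains a \<Phi> \<rho> m where "catalytic_map a b (W * real_diag b s * mat_adjoint W) \<Phi>"
    "quantum_state (1 * a) \<rho>" "1 \<le> largest_eigenvalue \<rho>" "m < b"
    "largest_eigenvalue (id_tensor_map 1 a \<Phi> \<rho>) \<le> s m / real (card {l. l < b \<and> s l = s m})"
proof -
  obtain N :: nat and \<pi> :: "nat \<Rightarrow> nat \<Rightarrow> nat" where N: "0 < N" and \<pi>: "\<And>y m. m < b \<Longrightarrow> \<pi> y m < b"
    "\<And>y m. m < b \<Longrightarrow> s (\<pi> y m) = s m" "\<And>y. inj_on (\<pi> y) {..<b}"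
    "\<And>x m. m < b \<Longrightarrow> card {y. y < N \<and> \<pi> y m = \<pi> x m} * card {l. l < b \<and> s l = s m} = N"
    by (rule level_shifts_exist[of b s]) blast
  have b: "0 < b" using s(2) by (cases b) auto
  define a where "a = b * N"
  have a: "0 < a" "N \<le> a" using b N by (auto simp: a_def)
  \<comment> \<open>In \<open>x\<close>, the quotient by \<open>N\<close> is the first register and
    the remainder the second; only the first is advanced by \<open>m\<close>.\<close>
  define sh where "sh x m = ((x div N + m) mod b) * N + x mod N" for x m
  have sh_less: "sh x m < a" for x m
    unfolding sh_def a_def using b N by (intro product_index_less) auto
  have sh_inj: "x = y" if "x < a" "y < a" "sh x m = sh y m" for x y m
  proof -
    have "(x div N + m) mod b = (y div N + m) mod b \<and> x mod N = y mod N"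
      using that(3) N unfolding sh_def by (subst (asm) product_index_eq_iff) auto
    hence "x mod N = y mod N" "(m + x div N) mod b = (m + y div N) mod b"
      by (simp_all add: add.commute)
    moreover from this(2) have "x div N mod b = y div N mod b" by (simp only: add_mod_cancel_left)
    moreover have "x div N < b" "y div N < b" using that(1,2) by (auto simp: a_def less_mult_imp_div_less)
    ultimately have "x div N = y div N" "x mod N = y mod N" by auto
    thus ?thesis by (metis div_mult_mod_eq)
  qed
  define f where "f z = sh (z div b) (z mod b) * b + \<pi> (z div b mod N) (z mod b)" for z
  define G where "G = mat (a * b) (a * b) (\<lambda>(i, j). if i = f j then 1 else 0 :: complex)"
  have f_less: "f z < a * b" for z
    unfolding f_def using b by (intro product_index_less sh_less \<pi>(1)) auto
  have "inj_on f {..<a * b}"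
  proof (rule inj_onI)
    fix z z' assume z: "z \<in> {..<a * b}" "z' \<in> {..<a * b}" "f z = f z'"
    from z(1) have "z < a * b" by simp
    then obtain x m where x: "x < a" "m < b" "z = x * b + m" by (rule product_index_cases)
    from z(2) have "z' < a * b" by simp
    then obtain y l where y: "y < a" "l < b" "z' = y * b + l" by (rule product_index_cases)
    have "sh x m = sh y l" "\<pi> (x mod N) m = \<pi> (y mod N) l"
      using z(3) x y by (auto simp: f_def product_index_eq_iff \<pi>(1))
    \<comment> \<open>The second register is never changed, so it reveals which shift was applied;
      inverting that shift recovers \<open>m\<close>, and then \<open>sh\<close> recovers
      \<open>x\<close>.\<close>
    moreover from this(1) have "x mod N = y mod N" using N by (auto simp: sh_def product_index_eq_iff)
    ultimately have "m = l" using \<pi>(3)[of "y mod N"] x(2) y(2) by (auto simp: inj_on_eq_iff)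
    with \<open>sh x m = sh y l\<close> have "x = y" using sh_inj x(1) y(1) by blast
    with \<open>m = l\<close> show "z = z'" using x y by simp
  qed
  hence G: "unitary_mat (a * b) G"
    unfolding G_def using f_less by (intro unitary_permutation_mat) auto
  note Gc = unitary_matD[OF G]
  have Gi: "G $$ (i * b + l, x * b + m) = (if i = sh x m \<and> l = \<pi> (x mod N) m then 1 else 0)"
    if "i < a" "l < b" "x < a" "m < b" for i l x m
    using that by (simp add: G_def f_def product_index_less product_index_eq_iff \<pi>(1))
  have cat: "trace_fst a b (G * tensor_mat \<rho> (real_diag b s) * mat_adjoint G) = real_diag b s"
    if \<rho>: "quantum_state a \<rho>" for \<rho>
  proof (rule eq_matI)
    note \<rho>c = quantum_stateD[OF \<rho>]
    fix l l' assume "l < dim_row (real_diag b s)" "l' < dim_col (real_diag b s)"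
    hence l: "l < b" "l' < b" by (auto simp: real_diag_def)
    \<comment> \<open>For fixed \<open>y\<close> the shift permutes the basis within levels of equal
      weight, so it leaves the diagonal catalyst invariant.\<close>
    have shift: "(\<Sum>m<b. if l = \<pi> y m then complex_of_real (s m) else 0) = complex_of_real (s l)" for y
    proof -
      have "\<pi> y ` {..<b} = {..<b}"
        by (rule endo_inj_surj[OF _ _ \<pi>(3)]) (auto intro: \<pi>(1))
      hence "bij_betw (\<pi> y) {..<b} {..<b}" using \<pi>(3) by (simp add: bij_betw_def)
      hence "(\<Sum>m<b. if l = \<pi> y m then complex_of_real (s (\<pi> y m)) else 0)
          = (\<Sum>m<b. if l = m then complex_of_real (s m) else 0)"
        by (rule sum.reindex_bij_betw)
      moreover have "(\<Sum>m<b. if l = \<pi> y m then complex_of_real (s m) else 0)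
          = (\<Sum>m<b. if l = \<pi> y m then complex_of_real (s (\<pi> y m)) else 0)"
        by (intro sum.cong) (auto simp: \<pi>(2))
      ultimately show ?thesis using l by simp
    qed
    have "trace_fst a b (G * tensor_mat \<rho> (real_diag b s) * mat_adjoint G) $$ (l, l')
        = (\<Sum>i<a. \<Sum>m<b. \<Sum>x<a. \<Sum>y<a. complex_of_real (s m) *
            (G $$ (i * b + l, x * b + m) * \<rho> $$ (x, y) * cnj (G $$ (i * b + l', y * b + m))))"
      unfolding trace_fst_index[OF l] using l
      by (intro sum.cong refl dilation_index[OF Gc(1) \<rho>c(1)] product_index_less) auto
    \<comment> \<open>For fixed \<open>m\<close> the output position \<open>i\<close> determines the
      input position, so coherences of \<open>\<rho>\<close> do not contribute, whatever the input
      state is.\<close>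
    also have "\<dots> = (\<Sum>i<a. \<Sum>m<b. \<Sum>x<a. \<Sum>y<a. if y = x then if i = sh x m then
        (if l = \<pi> (x mod N) m then if l = l' then complex_of_real (s m) * \<rho> $$ (x, x) else 0 else 0) else 0 else 0)"
      using l sh_inj by (intro sum.cong refl) (auto simp: Gi)
    also have "\<dots> = (\<Sum>i<a. \<Sum>m<b. \<Sum>x<a. if i = sh x m then
        (if l = \<pi> (x mod N) m then if l = l' then complex_of_real (s m) * \<rho> $$ (x, x) else 0 else 0) else 0)"
      by (intro sum.cong refl) simp
    also have "\<dots> = (\<Sum>m<b. \<Sum>i<a. \<Sum>x<a. if i = sh x m then
        (if l = \<pi> (x mod N) m then if l = l' then complex_of_real (s m) * \<rho> $$ (x, x) else 0 else 0) else 0)"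
      by (rule sum.swap)
    also have "\<dots> = (\<Sum>m<b. \<Sum>x<a. \<Sum>i<a. if i = sh x m then
        (if l = \<pi> (x mod N) m then if l = l' then complex_of_real (s m) * \<rho> $$ (x, x) else 0 else 0) else 0)"
      by (intro sum.cong refl sum.swap)
    also have "\<dots> = (\<Sum>m<b. \<Sum>x<a.
        if l = \<pi> (x mod N) m then if l = l' then complex_of_real (s m) * \<rho> $$ (x, x) else 0 else 0)"
      by (intro sum.cong refl) (simp add: sh_less)
    also have "\<dots> = (\<Sum>x<a. \<Sum>m<b.
        if l = \<pi> (x mod N) m then if l = l' then complex_of_real (s m) * \<rho> $$ (x, x) else 0 else 0)"
      by (rule sum.swap)
    also have "\<dots> = (\<Sum>x<a. (\<Sum>m<b. if l = \<pi> (x mod N) m then complex_of_real (s m) else 0)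
        * (if l = l' then \<rho> $$ (x, x) else 0))"
      unfolding sum_distrib_right by (intro sum.cong refl) auto
    also have "\<dots> = (if l = l' then complex_of_real (s l) * mat_trace \<rho> else 0)"
      unfolding shift mat_trace_sum[OF \<rho>c(1)] by (simp add: sum_distrib_left)
    finally show "trace_fst a b (G * tensor_mat \<rho> (real_diag b s) * mat_adjoint G) $$ (l, l') = real_diag b s $$ (l, l')"
      using l \<rho>c(4) by simp
  qed (auto simp: real_diag_def)
  define \<Phi> where "\<Phi> = dilated_map a b G (real_diag b s)"
  have catalytic: "catalytic_map a b (W * real_diag b s * mat_adjoint W) \<Phi>"
    unfolding \<Phi>_def by (rule catalytic_map_dilated_mapI[OF G s W cat])
  define \<rho> where "\<rho> = uniform_state a N"
  have \<rho>c: "\<rho> \<in> carrier_mat a a" by (simp add: \<rho>_def uniform_state_def)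
  have \<rho>: "quantum_state (1 * a) \<rho>" "1 \<le> largest_eigenvalue \<rho>"
    unfolding \<rho>_def using quantum_state_uniform_state[OF N a(2)] largest_eigenvalue_uniform_state[OF N a(2)] by auto
  define M where "M = id_tensor_map 1 a \<Phi> \<rho>"
  have M: "quantum_state a M"
    using quantum_state_id_tensor_map[OF _ \<rho>(1), of \<Phi>] catalytic by (simp add: M_def catalytic_map_def)
  note Mc = quantum_stateD[OF M]
  \<comment> \<open>The first register ends up equal to the catalyst value, hence
    \<open>u = v\<close>; the coherence between \<open>x\<close> and \<open>y\<close> survives
    exactly when both shifts send the catalyst to the same state.\<close>
  have Mi: "M $$ (u * N + x, v * N + y)
      = (if u = v \<and> \<pi> x u = \<pi> y u then complex_of_real (s u / real N) else 0)"
    if uv: "u < b" "x < N" "v < b" "y < N" for u x v y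
  proof -
    have less: "u * N + x < a" "v * N + y < a" unfolding a_def using uv by (auto intro: product_index_less)
    have blk: "mat_block a \<rho> 0 0 = \<rho>" using \<rho>c by (auto simp: mat_block_def)
    have "M $$ (u * N + x, v * N + y) = dilated_map a b G (real_diag b s) \<rho> $$ (u * N + x, v * N + y)"
      using less by (simp add: M_def \<Phi>_def id_tensor_map_def blk)
    also have "\<dots> = (\<Sum>l<b. \<Sum>m<b. \<Sum>x'<a. \<Sum>y'<a. complex_of_real (s m) *
        (kraus_mat a b G l m $$ (u * N + x, x') * \<rho> $$ (x', y') * cnj (kraus_mat a b G l m $$ (v * N + y, y'))))"
      by (rule dilated_map_index[OF Gc(1) \<rho>c less])
    also have "\<dots> = (\<Sum>l<b. \<Sum>m<b. \<Sum>x'<a. \<Sum>y'<a. if y' = y then if x' = x then if m = u then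
        if l = \<pi> x u then if u = v \<and> \<pi> x u = \<pi> y u then complex_of_real (s u / real N) else 0 else 0 else 0 else 0 else 0)"
    proof (intro sum.cong refl)
      fix l m x' y' assume "l \<in> {..<b}" "m \<in> {..<b}" "x' \<in> {..<a}" "y' \<in> {..<a}"
      hence *: "l < b" "m < b" "x' < a" "y' < a" by auto
      show "complex_of_real (s m) *
          (kraus_mat a b G l m $$ (u * N + x, x') * \<rho> $$ (x', y') * cnj (kraus_mat a b G l m $$ (v * N + y, y')))
        = (if y' = y then if x' = x then if m = u then
        if l = \<pi> x u then if u = v \<and> \<pi> x u = \<pi> y u then complex_of_real (s u / real N) else 0 else 0 else 0 else 0 else 0)"
      proof (cases "x' < N \<and> y' < N")
        case True
        \<comment> \<open>On the support of the prepared state the first register is 0, so the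
          record is \<open>m\<close> itself, without wrap-around.\<close>
        hence "sh x' m = m * N + x'" "sh y' m = m * N + y'" using * by (simp_all add: sh_def)
        hence 1: "kraus_mat a b G l m $$ (u * N + x, x') = (if u = m \<and> x = x' \<and> l = \<pi> x' m then 1 else 0)"
          "kraus_mat a b G l m $$ (v * N + y, y') = (if v = m \<and> y = y' \<and> l = \<pi> y' m then 1 else 0)"
          using * less uv True by (simp_all add: Gi product_index_eq_iff)
        have "\<rho> $$ (x', y') = 1 / of_nat N" using True * by (simp add: \<rho>_def uniform_state_def)
        thus ?thesis unfolding 1 by (cases "x' = x"; cases "y' = y"; cases "m = u") auto
      next
        case False
        hence "\<rho> $$ (x', y') = 0" using * by (auto simp: \<rho>_def uniform_state_def)
        moreover have "x' \<noteq> x \<or> y' \<noteq> y" using False uv by auto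
        ultimately show ?thesis by auto
      qed
    qed
    also have "\<dots> = (\<Sum>l<b. \<Sum>m<b. \<Sum>x'<a. if x' = x then if m = u then
        if l = \<pi> x u then if u = v \<and> \<pi> x u = \<pi> y u then complex_of_real (s u / real N) else 0 else 0 else 0 else 0)"
      using uv a(2) by (intro sum.cong refl) simp
    also have "\<dots> = (\<Sum>l<b. \<Sum>m<b. if m = u then
        if l = \<pi> x u then if u = v \<and> \<pi> x u = \<pi> y u then complex_of_real (s u / real N) else 0 else 0 else 0)"
      using uv a(2) by (intro sum.cong refl) simp
    also have "\<dots> = (if u = v \<and> \<pi> x u = \<pi> y u then complex_of_real (s u / real N) else 0)"
      using uv \<pi>(1)[of u x] by simp
    finally show ?thesis .
  qed
  \<comment> \<open>By the coincidence count, a row has \<open>N / r\<close> positions carrying the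
    value \<open>s u / N\<close>, where \<open>r\<close> is the size of the level of
    \<open>u\<close>.\<close>
  have row: "(\<Sum>j<a. cmod (M $$ (u * N + x, j))) = s u / real (card {l. l < b \<and> s l = s u})"
    if u: "u < b" "x < N" for u x
  proof -
    let ?c = "card {y. y < N \<and> \<pi> y u = \<pi> x u}" and ?r = "card {l. l < b \<and> s l = s u}"
    have "(\<Sum>j<a. cmod (M $$ (u * N + x, j))) = (\<Sum>v<b. \<Sum>y<N. cmod (M $$ (u * N + x, v * N + y)))"
      unfolding a_def by (rule sum_product_index)
    also have "\<dots> = (\<Sum>v<b. if v = u then (\<Sum>y<N. if \<pi> y u = \<pi> x u then s u / real N else 0) else 0)"
      using u s(1)[OF u(1)] by (intro sum.cong refl) (auto simp: Mi norm_divide intro!: sum.cong)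
    also have "\<dots> = (\<Sum>y<N. if \<pi> y u = \<pi> x u then s u / real N else 0)" using u by simp
    also have "\<dots> = real ?c * (s u / real N)"
      by (subst sum.inter_filter[symmetric]) (auto simp: lessThan_def)
    also have "\<dots> = s u / real ?r"
    proof -
      have "real ?c * real ?r = real N" using \<pi>(4)[OF u(1), of x] by (simp flip: of_nat_mult)
      moreover have "real ?r \<noteq> 0" using u(1) by auto
      ultimately show ?thesis using N by (simp add: field_simps)
    qed
    finally show ?thesis .
  qed
  have L: "0 < largest_eigenvalue M" by (rule quantum_state_largest_eigenvalue_pos[OF M])
  obtain i where i: "i < a" "cmod (complex_of_real (largest_eigenvalue M)) \<le> (\<Sum>j<a. cmod (M $$ (i, j)))"
    by (rule eigenvalue_le_row_sum[OF Mc(1,5) largest_eigenvalue_in_spectrum[OF Mc(2,5)]])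
  from i(1) obtain u x where "u < b" "x < N" "i = u * N + x" unfolding a_def by (rule product_index_cases)
  with i(2) L row have "largest_eigenvalue M \<le> s u / real (card {l. l < b \<and> s l = s u})" by simp
  with catalytic \<rho> \<open>u < b\<close> show thesis unfolding M_def by (intro that)
qed

subsection \<open>Eigenprojectors\<close>

lemma mat_eqI_vec:
  fixes A B :: "complex mat"
  assumes "A \<in> carrier_mat n n" "B \<in> carrier_mat n n"
    and "\<And>v. v \<in> carrier_vec n \<Longrightarrow> A *\<^sub>v v = B *\<^sub>v v"
  shows "A = B"
proof (rule eq_matI)
  fix i j assume "i < dim_row B" "j < dim_col B"
  hence ij: "i < n" "j < n" using assms by auto
  have "(M *\<^sub>v unit_vec n j) $ i = M $$ (i, j)" if "M \<in> carrier_mat n n" for M :: "complex mat"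
  proof -
    have "(M *\<^sub>v unit_vec n j) $ i = (\<Sum>x<n. M $$ (i, x) * unit_vec n j $ x)"
      using that ij by (intro mult_mat_vec_sum) auto
    also have "\<dots> = (\<Sum>x<n. if x = j then M $$ (i, x) else 0)"
      using ij by (intro sum.cong) auto
    finally show ?thesis using ij by simp
  qed
  thus "A $$ (i, j) = B $$ (i, j)" using assms by (metis unit_vec_carrier)
qed (use assms in auto)

text \<open>An idempotent acts as the identity on its image, so \<open>Q * P = P\<close> and
  \<open>P * Q = Q\<close>; cyclicity of the trace does the rest.\<close>

lemma mat_trace_eq_of_same_image:
  assumes P: "P \<in> carrier_mat n n" "P * P = P" "(\<lambda>v. P *\<^sub>v v) ` carrier_vec n = E"
    and Q: "Q \<in> carrier_mat n n" "Q * Q = Q" "(\<lambda>v. Q *\<^sub>v v) ` carrier_vec n = E"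
  shows "mat_trace P = mat_trace (Q :: complex mat)"
proof -
  have absorb: "A * B = B"
    if A: "A \<in> carrier_mat n n" "A * A = A" "(\<lambda>v. A *\<^sub>v v) ` carrier_vec n = E"
      and B: "B \<in> carrier_mat n n" "(\<lambda>v. B *\<^sub>v v) ` carrier_vec n = E" for A B :: "complex mat"
  proof (rule mat_eqI_vec[of _ n])
    fix v :: "complex vec" assume v: "v \<in> carrier_vec n"
    hence "B *\<^sub>v v \<in> (\<lambda>v. A *\<^sub>v v) ` carrier_vec n" using A(3) B(2) by blast
    then obtain w where w: "w \<in> carrier_vec n" "B *\<^sub>v v = A *\<^sub>v w" by auto
    have "(A * B) *\<^sub>v v = A *\<^sub>v (A *\<^sub>v w)" using A(1) B(1) v w by (simp add: assoc_mult_mat_vec[of _ n n _ n])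
    also have "\<dots> = (A * A) *\<^sub>v w" using A(1) w by (simp add: assoc_mult_mat_vec[of _ n n _ n])
    finally show "(A * B) *\<^sub>v v = B *\<^sub>v v" using A(2) w by simp
  qed (use A B in auto)
  have "mat_trace P = mat_trace (Q * P)" using absorb[OF Q P(1,3)] by simp
  also have "\<dots> = mat_trace (P * Q)" by (rule mat_trace_mult_commute[OF Q(1) P(1)])
  also have "P * Q = Q" by (rule absorb[OF P Q(1,3)])
  finally show ?thesis .
qed

lemma real_diag_mult: "real_diag n f * real_diag n g = real_diag n (\<lambda>i. f i * g i)"
proof (rule eq_matI)
  fix i j assume "i < dim_row (real_diag n (\<lambda>i. f i * g i))" "j < dim_col (real_diag n (\<lambda>i. f i * g i))"
  hence ij: "i < n" "j < n" by (auto simp: real_diag_def)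
  have "(real_diag n f * real_diag n g) $$ (i, j) = (\<Sum>x<n. real_diag n f $$ (i, x) * real_diag n g $$ (x, j))"
    using ij by (intro index_mult_mat_sum) auto
  also have "\<dots> = (\<Sum>x<n. if x = i then real_diag n (\<lambda>i. f i * g i) $$ (i, j) else 0)"
    using ij by (intro sum.cong) auto
  finally show "(real_diag n f * real_diag n g) $$ (i, j) = real_diag n (\<lambda>i. f i * g i) $$ (i, j)"
    using ij by simp
qed (auto simp: real_diag_def)

lemma conj_mult:
  assumes "unitary_mat n W" "A \<in> carrier_mat n n" "B \<in> carrier_mat n n"
  shows "(W * A * mat_adjoint W) * (W * B * mat_adjoint W) = W * (A * B) * mat_adjoint W"
proof -
  note W = unitary_matD[OF assms(1)]
  show ?thesis using W assms
    by (simp add: square_mult_assoc[of _ n] adjoint_mult_cancel(1)[OF assms(1), of _ n])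
qed

text \<open>Compares \<open>P\<close> with the explicit projector \<open>Q\<close> that selects the
  positions of level \<open>c\<close> in the eigenbasis. The two have the same image, and the trace
  of \<open>Q\<close> counts positions. This links the given multiplicities to
  \<open>s\<close>.\<close>

lemma eigenspace_projector_trace:
  assumes W: "unitary_mat n W"
    and P: "orthogonal_projector_onto n (eigenspace n (W * real_diag n s * mat_adjoint W) (complex_of_real c)) P"
  shows "mat_trace P = of_nat (card {l. l < n \<and> s l = c})"
proof -
  note Wc = unitary_matD[OF W]
  let ?\<sigma> = "W * real_diag n s * mat_adjoint W"
  define e :: "nat \<Rightarrow> real" where "e l = (if s l = c then 1 else 0)" for l
  define Q where "Q = W * real_diag n e * mat_adjoint W"
  have Q: "Q \<in> carrier_mat n n" using Wc by (simp add: Q_def)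
  have \<sigma>: "?\<sigma> \<in> carrier_mat n n" using Wc by simp
  have "(\<lambda>l. e l * e l) = e" by (auto simp: e_def)
  hence QQ: "Q * Q = Q" unfolding Q_def conj_mult[OF W real_diag_carrier real_diag_carrier] real_diag_mult by simp
  have "(\<lambda>l. s l * e l) = (\<lambda>l. c * e l)" by (auto simp: e_def)
  hence "?\<sigma> * Q = W * real_diag n (\<lambda>l. c * e l) * mat_adjoint W"
    unfolding Q_def conj_mult[OF W real_diag_carrier real_diag_carrier] real_diag_mult by simp
  also have "\<dots> = complex_of_real c \<cdot>\<^sub>m Q"
  proof (rule eq_matI)
    fix i j assume "i < dim_row (complex_of_real c \<cdot>\<^sub>m Q)" "j < dim_col (complex_of_real c \<cdot>\<^sub>m Q)"
    hence ij: "i < n" "j < n" using Q by auto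
    thus "(W * real_diag n (\<lambda>l. c * e l) * mat_adjoint W) $$ (i, j) = (complex_of_real c \<cdot>\<^sub>m Q) $$ (i, j)"
      using Q carrier_matD[OF Q] unfolding conj_real_diag_index[OF Wc(1) ij]
      by (simp add: Q_def conj_real_diag_index[OF Wc(1) ij] sum_distrib_left mult.assoc del: index_mult_mat)
  qed (use Q Wc in auto)
  finally have \<sigma>Q: "?\<sigma> * Q = complex_of_real c \<cdot>\<^sub>m Q" .
  have img: "(\<lambda>v. Q *\<^sub>v v) ` carrier_vec n = eigenspace n ?\<sigma> (complex_of_real c)"
  proof
    show "(\<lambda>v. Q *\<^sub>v v) ` carrier_vec n \<subseteq> eigenspace n ?\<sigma> (complex_of_real c)"
    proof
      fix w assume "w \<in> (\<lambda>v. Q *\<^sub>v v) ` carrier_vec n"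
      then obtain v where v: "v \<in> carrier_vec n" "w = Q *\<^sub>v v" by auto
      have w: "w \<in> carrier_vec n" unfolding v(2) by (rule mult_mat_vec_carrier[OF Q v(1)])
      have "?\<sigma> *\<^sub>v w = (?\<sigma> * Q) *\<^sub>v v" unfolding v(2) by (rule assoc_mult_mat_vec[symmetric, OF \<sigma> Q v(1)])
      also have "\<dots> = complex_of_real c \<cdot>\<^sub>v w"
        unfolding \<sigma>Q v(2) using Q v(1) by (intro eq_vecI) auto
      finally show "w \<in> eigenspace n ?\<sigma> (complex_of_real c)" using w by (simp add: eigenspace_def)
    qed
    show "eigenspace n ?\<sigma> (complex_of_real c) \<subseteq> (\<lambda>v. Q *\<^sub>v v) ` carrier_vec n"
    proof
      fix v assume "v \<in> eigenspace n ?\<sigma> (complex_of_real c)"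
      hence v: "v \<in> carrier_vec n" "?\<sigma> *\<^sub>v v = complex_of_real c \<cdot>\<^sub>v v" by (auto simp: eigenspace_def)
      define w where "w = mat_adjoint W *\<^sub>v v"
      have w: "w \<in> carrier_vec n" unfolding w_def by (rule mult_mat_vec_carrier[OF Wc(2) v(1)])
      note diag = real_diag_mult_vec_index[OF w]
      have conj: "mat_adjoint W *\<^sub>v ((W * real_diag n f * mat_adjoint W) *\<^sub>v v) = real_diag n f *\<^sub>v w"
        "(W * real_diag n f * mat_adjoint W) *\<^sub>v v = W *\<^sub>v (real_diag n f *\<^sub>v w)" for f
      proof -
        show *: "(W * real_diag n f * mat_adjoint W) *\<^sub>v v = W *\<^sub>v (real_diag n f *\<^sub>v w)"
          unfolding w_def using Wc v(1)
          by (simp add: square_mult_assoc[of _ n] assoc_mult_mat_vec[of _ n n _ n] mult_mat_vec_carrier[of _ n n])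
        have Dw: "real_diag n f *\<^sub>v w \<in> carrier_vec n" by (rule mult_mat_vec_carrier[OF real_diag_carrier w])
        have "mat_adjoint W *\<^sub>v (W *\<^sub>v (real_diag n f *\<^sub>v w)) = (mat_adjoint W * W) *\<^sub>v (real_diag n f *\<^sub>v w)"
          by (rule assoc_mult_mat_vec[symmetric, OF Wc(2,1) Dw])
        thus "mat_adjoint W *\<^sub>v ((W * real_diag n f * mat_adjoint W) *\<^sub>v v) = real_diag n f *\<^sub>v w"
          unfolding * using Wc(3) Dw by simp
      qed
      have "real_diag n s *\<^sub>v w = mat_adjoint W *\<^sub>v (complex_of_real c \<cdot>\<^sub>v v)" using conj(1)[of s] v(2) by simp
      also have "\<dots> = complex_of_real c \<cdot>\<^sub>v w" unfolding w_def by (rule mult_mat_vec[OF Wc(2) v(1)])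
      finally have sw: "real_diag n s *\<^sub>v w = complex_of_real c \<cdot>\<^sub>v w" .
      have "real_diag n e *\<^sub>v w = w"
      proof (rule eq_vecI)
        fix l assume "l < dim_vec w"
        hence l: "l < n" using w by simp
        \<comment> \<open>In eigenbasis coordinates \<open>w\<close> must vanish at every position
          with \<open>s l \<noteq> c\<close>, and on such vectors the indicator \<open>e\<close>
          acts as the identity.\<close>
        have "complex_of_real (s l) * w $ l = complex_of_real c * w $ l"
          using arg_cong[OF sw, of "\<lambda>x. x $ l"] diag[OF l, of s] w l by simp
        thus "(real_diag n e *\<^sub>v w) $ l = w $ l" unfolding diag[OF l] by (auto simp: e_def)
      qed (use w in \<open>auto simp: real_diag_def\<close>)
      hence "Q *\<^sub>v v = W *\<^sub>v w" unfolding Q_def conj(2) by simp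
      also have "\<dots> = (W * mat_adjoint W) *\<^sub>v v"
        unfolding w_def by (rule assoc_mult_mat_vec[symmetric, OF Wc(1,2) v(1)])
      finally have "v = Q *\<^sub>v v" using Wc v(1) by simp
      thus "v \<in> (\<lambda>v. Q *\<^sub>v v) ` carrier_vec n" using v(1) by blast
    qed
  qed
  have "mat_trace P = mat_trace Q"
    using P by (intro mat_trace_eq_of_same_image[OF _ _ _ Q QQ img])
      (auto simp: orthogonal_projector_onto_def hermitian_mat_def)
  also have "\<dots> = complex_of_real (\<Sum>l<n. e l)"
    unfolding Q_def mat_trace_unitary_conj[OF W real_diag_carrier] by (rule mat_trace_real_diag)
  also have "(\<Sum>l<n. e l) = (\<Sum>l\<in>{l. l < n \<and> s l = c}. 1)"
    by (intro sum.mono_neutral_cong_right) (auto simp: e_def)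
  also have "\<dots> = real (card {l. l < n \<and> s l = c})" by simp
  finally show ?thesis by simp
qed

theorem theorem8:
  fixes dB :: nat
    and \<sigma> :: "complex mat"
    and I :: "'i set"
    and lam :: "'i \<Rightarrow> real"
    and P :: "'i \<Rightarrow> complex mat"
    and r :: "'i \<Rightarrow> real"
  assumes "quantum_state dB \<sigma>"
    and "eigenspace_decomposition dB \<sigma> I lam P"
    and "\<And>i. i \<in> I \<Longrightarrow> complex_of_real (r i) = mat_trace (P i)"
  shows "is_maximal_extractable_min_entropy dB \<sigma> (catalytic_min_entropy I lam r)"
proof -
  obtain W s where W: "unitary_mat dB W" "\<sigma> = W * real_diag dB s * mat_adjoint W"
    and s: "\<And>m. m < dB \<Longrightarrow> 0 \<le> s m" "(\<Sum>m<dB. s m) = 1"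
    by (rule quantum_state_spectral[OF assms(1)]) blast
  define R where "R m = real (card {l. l < dB \<and> s l = s m})" for m
  have R: "0 < R m" if "m < dB" for m
    unfolding R_def using that by (auto simp: card_gt_0_iff)
  have ev: "(\<lambda>i. complex_of_real (lam i)) ` I = (\<lambda>m. complex_of_real (s m)) ` {..<dB}"
    using assms(2) unfolding eigenspace_decomposition_def W(2) spectrum_conj_real_diag[OF W(1)] by blast
  have fin: "finite I" using assms(2) unfolding eigenspace_decomposition_def by blast
  \<comment> \<open>Dictionary between the index set \<open>I\<close> and basis positions, in both
    directions; many positions may share one index.\<close>
  have level: "\<exists>m<dB. lam i = s m \<and> r i = R m" if i: "i \<in> I" for i
  proof -
    from i ev obtain m where m: "m < dB" "lam i = s m" by (metis (no_types, lifting) image_iff lessThan_iff of_real_eq_iff)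
    have "orthogonal_projector_onto dB (eigenspace dB \<sigma> (complex_of_real (s m))) (P i)"
      using assms(2) i m(2) unfolding eigenspace_decomposition_def by auto
    hence "mat_trace (P i) = of_nat (card {l. l < dB \<and> s l = s m})"
      unfolding W(2) by (rule eigenspace_projector_trace[OF W(1)])
    hence "complex_of_real (r i) = complex_of_real (R m)" using assms(3)[OF i] by (simp add: R_def)
    with m show ?thesis by (auto simp only: of_real_eq_iff)
  qed
  have level': "\<exists>i\<in>I. lam i = s m \<and> r i = R m" if m: "m < dB" for m
  proof -
    from m ev obtain i where i: "i \<in> I" "lam i = s m" by (metis (no_types, lifting) image_iff lessThan_iff of_real_eq_iff)
    from level[OF i(1)] obtain l where "lam i = s l" "r i = R l" by blast
    with i have "r i = R m" by (simp add: R_def)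
    with i show ?thesis by blast
  qed
  define T where "T = (\<lambda>i. log 2 (lam i / r i)) ` {i \<in> I. lam i \<noteq> 0}"
  have T: "finite T" using fin by (simp add: T_def)
  have T_ge: "log 2 (s m / R m) \<le> Max T" if "m < dB" "s m \<noteq> 0" for m
  proof (rule Max_ge[OF T])
    from level'[OF that(1)] obtain i where "i \<in> I" "lam i = s m" "r i = R m" by blast
    with that(2) show "log 2 (s m / R m) \<in> T" unfolding T_def by (intro image_eqI[of _ _ i]) auto
  qed
  \<comment> \<open>Some eigenvalue is nonzero because the trace is 1, so \<open>Max T\<close> is
    meaningful.\<close>
  have Tne: "T \<noteq> {}"
  proof
    assume "T = {}"
    hence "s m = 0" if "m < dB" for m using level'[OF that] by (force simp: T_def)
    thus False using s(2) by simp
  qed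
  have bound: "Max T \<le> log 2 (largest_eigenvalue (id_tensor_map dR dA \<Phi> \<rho>)) - log 2 (largest_eigenvalue \<rho>)"
    if cat: "catalytic_map dA dB \<sigma> \<Phi>" and \<rho>: "quantum_state (dR * dA) \<rho>" for dA dR \<Phi> \<rho>
  proof (rule Max.boundedI[OF T Tne])
    fix t assume "t \<in> T"
    then obtain i where i: "i \<in> I" "lam i \<noteq> 0" "t = log 2 (lam i / r i)" by (auto simp: T_def)
    from level[OF i(1)] obtain m where m: "m < dB" "lam i = s m" "r i = R m" by blast
    have pos: "0 < s m / R m" using s(1)[OF m(1)] R[OF m(1)] i(2) m(2) by auto
    have L: "0 < largest_eigenvalue \<rho>" by (rule quantum_state_largest_eigenvalue_pos[OF \<rho>])
    have "s m / R m * largest_eigenvalue \<rho> \<le> largest_eigenvalue (id_tensor_map dR dA \<Phi> \<rho>)"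
      unfolding R_def by (rule catalytic_map_largest_eigenvalue_ge[OF W(1) s cat[unfolded W(2)] \<rho> m(1)])
    hence le: "log 2 (s m / R m * largest_eigenvalue \<rho>) \<le> log 2 (largest_eigenvalue (id_tensor_map dR dA \<Phi> \<rho>))"
      using mult_pos_pos[OF pos L] by (intro log_mono) auto
    thus "t \<le> log 2 (largest_eigenvalue (id_tensor_map dR dA \<Phi> \<rho>)) - log 2 (largest_eigenvalue \<rho>)"
      using le[unfolded log_mult_pos[OF pos L]] m i(3) by simp
  qed
  obtain a \<Phi> \<rho> m where att: "catalytic_map a dB \<sigma> \<Phi>" "quantum_state (1 * a) \<rho>" "1 \<le> largest_eigenvalue \<rho>" "m < dB"
    "largest_eigenvalue (id_tensor_map 1 a \<Phi> \<rho>) \<le> s m / R m"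
    unfolding W(2) R_def by (rule catalytic_map_attaining_bound[OF W(1) s]) blast
  let ?L = "largest_eigenvalue (id_tensor_map 1 a \<Phi> \<rho>)"
  have "quantum_state (1 * a) (id_tensor_map 1 a \<Phi> \<rho>)"
    using att(1,2) by (intro quantum_state_id_tensor_map) (simp add: catalytic_map_def)
  hence L: "0 < ?L" by (rule quantum_state_largest_eigenvalue_pos)
  \<comment> \<open>The output has a positive top eigenvalue below \<open>s m / R m\<close>, so
    \<open>m\<close> belongs to a level that is represented in \<open>T\<close>.\<close>
  hence "s m \<noteq> 0" using att(5) by auto
  hence "log 2 (s m / R m) \<le> Max T" by (rule T_ge[OF att(4)])
  moreover have "log 2 ?L \<le> log 2 (s m / R m)" using L att(5) by (intro log_mono) auto
  moreover have "0 \<le> log 2 (largest_eigenvalue \<rho>)" using att(3) by simp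
  ultimately have "log 2 ?L - log 2 (largest_eigenvalue \<rho>) \<le> Max T" by linarith
  \<comment> \<open>Only one inequality was shown for the construction; the general bound, applied
    to the same map and state, supplies the other.\<close>
  with bound[OF att(1,2)] have eq: "min_entropy (id_tensor_map 1 a \<Phi> \<rho>) - min_entropy \<rho> = - Max T"
    by (simp add: min_entropy_def)
  have "- Max T \<in> extractable_min_entropies dB \<sigma>"
    unfolding extractable_min_entropies_def using eq[symmetric] att(1,2) by blast
  moreover have "x \<le> - Max T" if "x \<in> extractable_min_entropies dB \<sigma>" for x
    using that bound unfolding extractable_min_entropies_def min_entropy_def by force
  ultimately show ?thesis
    unfolding is_maximal_extractable_min_entropy_def catalytic_min_entropy_def T_def by blast
qed

end
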